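(* Let $X$ be an infinite h-homogeneous zero-dimensional compact Hausdorff space and $G=\mathrm{Homeo}(X)$ with the compact-open topology. Then: (1) the $G$-space $X$ is minimal; (2) the $G$-space $X$ is extremely proximal, i.e. for every closed set $\emptyset\ne F\subsetneq X$ there is a net $(g_i)_{i\in I}$ in $G$ and a point $x_0\in X$ with $\lim_i g_iF=\{x_0\}$ in $\mathrm{Exp}(X)$; (3) the minimal $G$-space $X$ is not isomorphic to the universal minimal $G$-space $M(G)$; (4) the $G$-space $\Phi(X)$ is minimal; (5) the $G$-space $\Phi(X)$ is proximal.
   Context: h-homogeneous: every nonempty clopen subset of $X$ is homeomorphic to $X$. $\mathrm{Exp}(X)$ is the space of nonempty closed subsets with the Vietoris topology; $\Phi(X)\subset\mathrm{Exp}(\mathrm{Exp}(X))$ is the compact space of maximal chains (maximal families of nonempty closed sets totally ordered by inclusion), with action $gc=\{gF:F\in c\}$. A $G$-space is minimal if it has no nonempty proper closed invariant subset; it is proximal if for any two points $y_1,y_2$ there is a net $g_i$ in $G$ with $\lim g_iy_1=\lim g_iy_2$. $M(G)$ is the universal minimal $G$-space: the unique (up to isomorphism) minimal $G$-space that maps continuously and equivariantly onto every minimal $G$-space. *)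

theory Defs
  imports "HOL-Analysis.Analysis"
begin

definition clopenin :: "'a topology \<Rightarrow> 'a set \<Rightarrow> bool" where
  "clopenin X U \<longleftrightarrow> closedin X U \<and> openin X U"

definition h_homogeneous :: "'a topology \<Rightarrow> bool" where
  "h_homogeneous X \<longleftrightarrow>
     (\<forall>U. clopenin X U \<and> U \<noteq> {} \<longrightarrow> subtopology X U homeomorphic_space X)"

text \<open>Zero-dimensional: small inductive dimension 0 (a base of clopen sets).\<close>
abbreviation zero_dimensional :: "'a topology \<Rightarrow> bool" where
  "zero_dimensional X \<equiv> X dim_le 0"

text \<open>Homeomorphisms of X, normalised to be the identity outside the carrier
  (so that they form a group under composition with unit id).\<close>
definition Homeo :: "'a topology \<Rightarrow> ('a \<Rightarrow> 'a) set" where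
  "Homeo X = {g. homeomorphic_map X X g \<and> (\<forall>x. x \<notin> topspace X \<longrightarrow> g x = x)}"

definition compact_open :: "'a topology \<Rightarrow> ('a \<Rightarrow> 'a) topology" where
  "compact_open X = topology_generated_by
     {{g \<in> Homeo X. g ` K \<subseteq> U} | K U. compactin X K \<and> openin X U}"

definition Exp_set :: "'a topology \<Rightarrow> 'a set set" where
  "Exp_set X = {F. closedin X F \<and> F \<noteq> {}}"

definition vietoris :: "'a topology \<Rightarrow> 'a set topology" where
  "vietoris X = topology_generated_by
     ({{F \<in> Exp_set X. F \<subseteq> U} | U. openin X U} \<union>
      {{F \<in> Exp_set X. F \<inter> U \<noteq> {}} | U. openin X U})"

definition chain_of_closed :: "'a topology \<Rightarrow> 'a set set \<Rightarrow> bool" where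
  "chain_of_closed X c \<longleftrightarrow> c \<subseteq> Exp_set X \<and> (\<forall>A\<in>c. \<forall>B\<in>c. A \<subseteq> B \<or> B \<subseteq> A)"

definition maximal_chain :: "'a topology \<Rightarrow> 'a set set \<Rightarrow> bool" where
  "maximal_chain X c \<longleftrightarrow> chain_of_closed X c \<and>
     (\<forall>d. chain_of_closed X d \<and> c \<subseteq> d \<longrightarrow> d = c)"

definition Phi :: "'a topology \<Rightarrow> 'a set set topology" where
  "Phi X = subtopology (vietoris (vietoris X)) {c. maximal_chain X c}"

definition Phi_act :: "('a \<Rightarrow> 'a) \<Rightarrow> 'a set set \<Rightarrow> 'a set set" where
  "Phi_act g c = (\<lambda>F. g ` F) ` c"

definition G_space :: "('a \<Rightarrow> 'a) topology \<Rightarrow> 'b topology \<Rightarrow> (('a \<Rightarrow> 'a) \<Rightarrow> 'b \<Rightarrow> 'b) \<Rightarrow> bool" where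
  "G_space T Y act \<longleftrightarrow>
     compact_space Y \<and> Hausdorff_space Y \<and>
     continuous_map (prod_topology T Y) Y (\<lambda>(g, y). act g y) \<and>
     (\<forall>y\<in>topspace Y. act id y = y) \<and>
     (\<forall>g\<in>topspace T. \<forall>h\<in>topspace T. \<forall>y\<in>topspace Y. act (g \<circ> h) y = act g (act h y))"

definition invariant :: "('a \<Rightarrow> 'a) set \<Rightarrow> (('a \<Rightarrow> 'a) \<Rightarrow> 'b \<Rightarrow> 'b) \<Rightarrow> 'b set \<Rightarrow> bool" where
  "invariant G act A \<longleftrightarrow> (\<forall>g\<in>G. \<forall>y\<in>A. act g y \<in> A)"

definition minimal_action :: "('a \<Rightarrow> 'a) set \<Rightarrow> 'b topology \<Rightarrow> (('a \<Rightarrow> 'a) \<Rightarrow> 'b \<Rightarrow> 'b) \<Rightarrow> bool" where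
  "minimal_action G Y act \<longleftrightarrow> topspace Y \<noteq> {} \<and>
     (\<forall>A. closedin Y A \<and> A \<noteq> {} \<and> invariant G act A \<longrightarrow> A = topspace Y)"

text \<open>Nets in G are represented by proper filters on the type of maps which
  eventually live in G (a net induces such a filter, and every such filter is
  the tail filter of a net).\<close>
definition net_in :: "('a \<Rightarrow> 'a) set \<Rightarrow> ('a \<Rightarrow> 'a) filter \<Rightarrow> bool" where
  "net_in G F \<longleftrightarrow> F \<noteq> bot \<and> eventually (\<lambda>g. g \<in> G) F"

definition proximal_action :: "('a \<Rightarrow> 'a) set \<Rightarrow> 'b topology \<Rightarrow> (('a \<Rightarrow> 'a) \<Rightarrow> 'b \<Rightarrow> 'b) \<Rightarrow> bool" where
  "proximal_action G Y act \<longleftrightarrow>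
     (\<forall>y1\<in>topspace Y. \<forall>y2\<in>topspace Y. \<exists>F z. net_in G F \<and>
        limitin Y (\<lambda>g. act g y1) z F \<and> limitin Y (\<lambda>g. act g y2) z F)"

definition extremely_proximal :: "('a \<Rightarrow> 'a) set \<Rightarrow> 'a topology \<Rightarrow> bool" where
  "extremely_proximal G X \<longleftrightarrow>
     (\<forall>F. closedin X F \<and> F \<noteq> {} \<and> F \<noteq> topspace X \<longrightarrow>
        (\<exists>N x0. net_in G N \<and> x0 \<in> topspace X \<and>
           limitin (vietoris X) (\<lambda>g. g ` F) {x0} N))"

definition G_map_onto :: "('a \<Rightarrow> 'a) set \<Rightarrow> 'b topology \<Rightarrow> (('a \<Rightarrow> 'a) \<Rightarrow> 'b \<Rightarrow> 'b)
    \<Rightarrow> 'c topology \<Rightarrow> (('a \<Rightarrow> 'a) \<Rightarrow> 'c \<Rightarrow> 'c) \<Rightarrow> ('b \<Rightarrow> 'c) \<Rightarrow> bool" where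
  "G_map_onto G Y act Z act' f \<longleftrightarrow>
     continuous_map Y Z f \<and> f ` topspace Y = topspace Z \<and>
     (\<forall>g\<in>G. \<forall>y\<in>topspace Y. f (act g y) = act' g (f y))"

text \<open>Universal minimal G-space.  Every minimal G-space is a quotient of the
  greatest ambit, hence has cardinality at most 2^2^|G|, so it is isomorphic
  to a G-space carried by a subset of the type ('a => 'a) set set; quantifying
  over that type therefore covers all minimal G-spaces up to isomorphism.\<close>
definition universal_minimal :: "('a \<Rightarrow> 'a) topology \<Rightarrow> 'b topology \<Rightarrow> (('a \<Rightarrow> 'a) \<Rightarrow> 'b \<Rightarrow> 'b) \<Rightarrow> bool" where
  "universal_minimal T Y act \<longleftrightarrow>
     G_space T Y act \<and> minimal_action (topspace T) Y act \<and>
     (\<forall>(Z :: ('a \<Rightarrow> 'a) set set topology) act'.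
        G_space T Z act' \<and> minimal_action (topspace T) Z act' \<longrightarrow>
        (\<exists>f. G_map_onto (topspace T) Y act Z act' f))"

end

theory Submission
  imports Defs
begin

text \<open>
  Locally constant maps \<open>q\<close> from \<open>X\<close> to a discrete set control everything. The traces \<open>q ` F\<close> of
  closed sets, and the families of traces of sets of closed sets, form bases of the iterated
  Vietoris topologies. A chain of closed sets is maximal iff it is closed and all its families of
  traces are maximal chains in a finite power set, which makes \<open>\<Phi>(X)\<close> compact. By
  h-homogeneity, two colourings with the same set of colours differ by a homeomorphism; minimality
  and extreme proximality of \<open>X\<close> are the two-colour case. For any two maximal chains and any finite
  set of colours \<open>0 < 1 < \<dots> < n\<close>, there is a colouring for which both families of traces
  consist of all initial segments. As each maximal chain has traces of this form after a permutation
  of the colours, any two points of \<open>\<Phi>(X)\<close> can be moved simultaneously into any given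
  nonempty open set, so \<open>\<Phi>(X)\<close> is minimal and proximal. If \<open>X\<close> were universal, there
  would be an equivariant map from \<open>X\<close> to \<open>\<Phi>(X)\<close>, and the stabiliser of a point would fix a
  maximal chain; a homeomorphism swapping two disjoint clopen sets excludes this.
\<close>

section \<open>The Vietoris topology\<close>

lemma topspace_vietoris [simp]: "topspace (vietoris X) = Exp_set X"
proof -
  have "Exp_set X = {F \<in> Exp_set X. F \<subseteq> topspace X}"
    by (auto simp: Exp_set_def dest: closedin_subset)
  then show ?thesis
    unfolding vietoris_def topology_generated_by_topspace by blast
qed

lemma openin_vietoris_subset:
  "openin X U \<Longrightarrow> openin (vietoris X) {F \<in> Exp_set X. F \<subseteq> U}"
  unfolding vietoris_def by (rule topology_generated_by_Basis) blast

lemma openin_vietoris_meets: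
  "openin X U \<Longrightarrow> openin (vietoris X) {F \<in> Exp_set X. F \<inter> U \<noteq> {}}"
  unfolding vietoris_def by (rule topology_generated_by_Basis) blast

text \<open>The right-hand side is the form in which the Alexander subbase theorem speaks of a
  topology, so that theorem becomes applicable to \<open>vietoris\<close>.\<close>

lemma topology_generated_by_eq_subbase:
  "topology_generated_by \<B> =
     topology (arbitrary union_of (finite intersection_of (\<lambda>x. x \<in> \<B>) relative_to \<Union>\<B>))"
    (is "?G = ?S")
proof (rule topology_eq[THEN iffD2], intro allI iffI)
  fix W assume "openin ?S W"
  show "openin ?G W"
    by (rule minimal_topology_subbase[OF _ _ \<open>openin ?S W\<close>])
       (use openin_topspace[of ?G] in \<open>auto intro: topology_generated_by_Basis\<close>)
next
  fix W assume "openin ?G W"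
  then have "generate_topology_on \<B> W"
    by (rule openin_topology_generated_by)
  then show "openin ?S W"
  proof induction
    case (Basis s)
    then have "((finite intersection_of (\<lambda>x. x \<in> \<B>)) relative_to \<Union>\<B>) s"
      unfolding relative_to_def
      by (intro exI[of _ s]) (auto intro: finite_intersection_of_inc)
    then show ?case
      by (simp add: istopology_subbase topology_inverse' union_of_inc arbitrary_union_of_inc)
  qed auto
qed

text \<open>Given a cover by subbasic sets, consider the closed set of points outside every
  \<open>U\<close> with \<open>Hit U\<close> in the cover. If nonempty, it is itself a point of the
  hyperspace and can only be covered by some \<open>Ins V\<close>; finitely many hitting sets then
  take care of the compact complement of \<open>V\<close>.\<close>

lemma compact_space_vietoris:
  assumes X: "compact_space X"
  shows "compact_space (vietoris X)"
proof -
  define Hit where "Hit U = {F \<in> Exp_set X. F \<inter> U \<noteq> {}}" for U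
  define Ins where "Ins U = {F \<in> Exp_set X. F \<subseteq> U}" for U
  define \<B> where "\<B> = {Ins U | U. openin X U} \<union> {Hit U | U. openin X U}"
  have vB: "vietoris X = topology_generated_by \<B>"
    unfolding vietoris_def \<B>_def Hit_def Ins_def ..
  have top: "\<Union>\<B> = Exp_set X"
    using topspace_vietoris[of X] unfolding vB topology_generated_by_topspace .
  show ?thesis
  proof (rule Alexander_subbase_alt)
    show "Exp_set X \<subseteq> \<Union>\<B>" using top by simp
    show "topology (arbitrary union_of (finite intersection_of (\<lambda>x. x \<in> \<B>) relative_to Exp_set X)) = vietoris X"
      by (simp add: vB topology_generated_by_eq_subbase top)
    fix C assume C: "C \<subseteq> \<B>" and cov: "Exp_set X \<subseteq> \<Union>C"
    define \<U> where "\<U> = {U. openin X U \<and> Hit U \<in> C}"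
    have oU: "openin X (\<Union>\<U>)" by (auto simp: \<U>_def)
    \<comment> \<open>\<open>V = {}\<close> stands for the case in which the sets in
      \<open>\<U>\<close> cover \<open>X\<close>, so that hitting sets alone cover the
      hyperspace.\<close>
    obtain V where V: "openin X V" "topspace X - V \<subseteq> \<Union>\<U>" "V = {} \<or> Ins V \<in> C"
    proof (cases "topspace X - \<Union>\<U> = {}")
      case True then show ?thesis using that[of "{}"] by auto
    next
      case False
      then have F: "topspace X - \<Union>\<U> \<in> Exp_set X"
        using oU by (auto simp: Exp_set_def)
      then obtain B where B: "B \<in> C" "topspace X - \<Union>\<U> \<in> B" using cov by blast
      from B(1) C consider U where "openin X U" "B = Ins U" | U where "openin X U" "B = Hit U"
        unfolding \<B>_def by blast
      then show ?thesis
      proof cases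
        case 1 then show ?thesis using B that[of U] by (auto simp: Ins_def)
      next
        case 2 then have "U \<in> \<U>" using B by (simp add: \<U>_def)
        then show ?thesis using B 2 by (auto simp: Hit_def)
      qed
    qed
    have "compactin X (topspace X - V)"
      using X V closedin_compact_space by blast
    then obtain \<F> where \<F>: "finite \<F>" "\<F> \<subseteq> \<U>" "topspace X - V \<subseteq> \<Union>\<F>"
      using V(2) unfolding compactin_def \<U>_def
      by (metis (no_types, lifting) mem_Collect_eq)
    show "\<exists>C'. finite C' \<and> C' \<subseteq> C \<and> Exp_set X \<subseteq> \<Union>C'"
    proof (intro exI conjI)
      show "finite (Hit ` \<F> \<union> ({Ins V} \<inter> C))" using \<F> by simp
      show "Hit ` \<F> \<union> ({Ins V} \<inter> C) \<subseteq> C" using \<F> by (auto simp: \<U>_def)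
      show "Exp_set X \<subseteq> \<Union>(Hit ` \<F> \<union> ({Ins V} \<inter> C))"
      proof
        fix F assume F: "F \<in> Exp_set X"
        then have FX: "F \<subseteq> topspace X" "F \<noteq> {}" by (auto simp: Exp_set_def dest: closedin_subset)
        show "F \<in> \<Union>(Hit ` \<F> \<union> ({Ins V} \<inter> C))"
        proof (cases "F \<subseteq> V")
          case True then show ?thesis using V F FX by (auto simp: Ins_def)
        next
          case False
          then obtain x U where "x \<in> F" "x \<in> U" "U \<in> \<F>" using FX \<F> by blast
          then show ?thesis using F by (auto simp: Hit_def)
        qed
      qed
    qed
  qed
qed

text \<open>Regularity separates a point of one set from the other set by \<open>U\<close> and
  \<open>V\<close>; no nonempty closed set can both meet \<open>U\<close> and lie inside the
  disjoint set \<open>V\<close>.\<close>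

lemma Hausdorff_space_vietoris:
  assumes X: "regular_space X"
  shows "Hausdorff_space (vietoris X)"
proof -
  have sep: "\<exists>\<U> \<V>. openin (vietoris X) \<U> \<and> openin (vietoris X) \<V> \<and> F \<in> \<U> \<and> F' \<in> \<V> \<and> disjnt \<U> \<V>"
    if F: "F \<in> Exp_set X" and F': "F' \<in> Exp_set X" and x: "x \<in> F" "x \<notin> F'" for F F' x
  proof -
    have "closedin X F'" "x \<in> topspace X - F'"
      using F F' x by (auto simp: Exp_set_def dest: closedin_subset)
    then obtain U V where UV: "openin X U" "openin X V" "x \<in> U" "F' \<subseteq> V" "disjnt U V"
      using X unfolding regular_space_def by metis
    then show ?thesis
      using openin_vietoris_meets[OF UV(1)] openin_vietoris_subset[OF UV(2)] F F' x
      by (intro exI[of _ "{F \<in> Exp_set X. F \<inter> U \<noteq> {}}"] exI[of _ "{F \<in> Exp_set X. F \<subseteq> V}"])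
         (auto simp: disjnt_def)
  qed
  show ?thesis
    unfolding Hausdorff_space_def topspace_vietoris
  proof (intro allI impI)
    fix F F' assume "F \<in> Exp_set X \<and> F' \<in> Exp_set X \<and> F \<noteq> F'"
    then have FF: "F \<in> Exp_set X" "F' \<in> Exp_set X" "F \<noteq> F'" by auto
    then consider x where "x \<in> F" "x \<notin> F'" | x where "x \<in> F'" "x \<notin> F" by blast
    then show "\<exists>U V. openin (vietoris X) U \<and> openin (vietoris X) V \<and> F \<in> U \<and> F' \<in> V \<and> disjnt U V"
      using sep[OF FF(1,2)] sep[OF FF(2,1)] by cases (blast, metis disjnt_sym)
  qed
qed

text \<open>Stated for an arbitrary compact Hausdorff \<open>Y\<close> so that it can be applied
  twice, from \<open>X\<close> to its hyperspace and from there to the second hyperspace. Preimages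
  of the two kinds of subbasic sets are treated separately.\<close>

lemma continuous_map_vietoris_action:
  assumes cont: "continuous_map (prod_topology T Y) Y (\<lambda>(g, y). act g y)"
    and Y: "compact_space Y" "Hausdorff_space Y"
  shows "continuous_map (prod_topology T (vietoris Y)) (vietoris Y) (\<lambda>(g, F). act g ` F)"
proof -
  have img: "act g ` F \<in> Exp_set Y" if "g \<in> topspace T" "F \<in> Exp_set Y" for g F
  proof -
    have "continuous_map Y Y (\<lambda>y. (\<lambda>(g, y). act g y) (g, y))"
      by (rule continuous_map_compose[OF _ cont, unfolded o_def])
         (use that in \<open>simp add: continuous_map_pairwise o_def\<close>)
    then have "closed_map Y Y (act g)"
      using continuous_imp_closed_map[OF _ Y] by simp
    then show ?thesis using that by (auto simp: closed_map_def Exp_set_def)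
  qed
  have W: "openin (prod_topology T Y) {z \<in> topspace (prod_topology T Y). (\<lambda>(g, y). act g y) z \<in> U}"
    if "openin Y U" for U
    using cont that by (rule openin_continuous_map_preimage)
  let ?P = "prod_topology T (vietoris Y)" and ?f = "\<lambda>(g, F). act g ` F"
  have sub: "openin ?P (?f -` {F \<in> Exp_set Y. F \<subseteq> U} \<inter> topspace ?P)" if U: "openin Y U" for U
  proof (subst openin_subopen, intro ballI)
    fix z assume z: "z \<in> ?f -` {F \<in> Exp_set Y. F \<subseteq> U} \<inter> topspace ?P"
    then obtain g F where gF: "z = (g, F)" "g \<in> topspace T" "F \<in> Exp_set Y" "act g ` F \<subseteq> U" by auto
    have cF: "compactin Y F" using gF Y closedin_compact_space by (auto simp: Exp_set_def)
    have gFW: "{g} \<times> F \<subseteq> {z \<in> topspace (prod_topology T Y). (\<lambda>(g, y). act g y) z \<in> U}"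
      using gF by (auto simp: Exp_set_def dest: closedin_subset)
    \<comment> \<open>Compactness of \<open>F\<close> yields one neighbourhood of \<open>g\<close>
      that works for all points of \<open>F\<close> at once.\<close>
    from tube_lemma_right[OF W[OF U] cF gF(2) gFW]
    obtain A B where AB: "openin T A" "openin Y B" "g \<in> A" "F \<subseteq> B"
      "A \<times> B \<subseteq> {z \<in> topspace (prod_topology T Y). (\<lambda>(g, y). act g y) z \<in> U}"
      by blast
    have ABU: "act h y \<in> U" if "h \<in> A" "y \<in> B" for h y
      using subsetD[OF AB(5), of "(h, y)"] that by simp
    have "openin ?P (A \<times> {F \<in> Exp_set Y. F \<subseteq> B})"
      using AB openin_vietoris_subset[OF AB(2)] by (simp add: openin_prod_Times_iff)
    moreover have "A \<times> {F \<in> Exp_set Y. F \<subseteq> B} \<subseteq> ?f -` {F \<in> Exp_set Y. F \<subseteq> U} \<inter> topspace ?P"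
    proof
      fix w assume "w \<in> A \<times> {F \<in> Exp_set Y. F \<subseteq> B}"
      then obtain h E where hE: "w = (h, E)" "h \<in> A" "E \<in> Exp_set Y" "E \<subseteq> B" by blast
      then have "h \<in> topspace T" using AB(1) openin_subset by blast
      moreover have "act h ` E \<subseteq> U" using hE ABU by blast
      ultimately show "w \<in> ?f -` {F \<in> Exp_set Y. F \<subseteq> U} \<inter> topspace ?P"
        using hE img by simp
    qed
    ultimately show "\<exists>S. openin ?P S \<and> z \<in> S \<and> S \<subseteq> ?f -` {F \<in> Exp_set Y. F \<subseteq> U} \<inter> topspace ?P"
      using gF AB by blast
  qed
  have meet: "openin ?P (?f -` {F \<in> Exp_set Y. F \<inter> U \<noteq> {}} \<inter> topspace ?P)" if U: "openin Y U" for U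
  proof (subst openin_subopen, intro ballI)
    fix z assume z: "z \<in> ?f -` {F \<in> Exp_set Y. F \<inter> U \<noteq> {}} \<inter> topspace ?P"
    then obtain g F y where gF: "z = (g, F)" "g \<in> topspace T" "F \<in> Exp_set Y" "y \<in> F" "act g y \<in> U"
      by auto
    then have "y \<in> topspace Y" by (auto simp: Exp_set_def dest: closedin_subset)
    \<comment> \<open>For a set that has to meet \<open>U\<close>, a product neighbourhood of a
      single witness \<open>(g, y)\<close> suffices.\<close>
    then have "(g, y) \<in> {z \<in> topspace (prod_topology T Y). (\<lambda>(g, y). act g y) z \<in> U}"
      using gF by auto
    from W[OF U, unfolded openin_prod_topology_alt, rule_format, OF this]
    obtain A B where AB: "openin T A" "openin Y B" "g \<in> A" "y \<in> B"
      "A \<times> B \<subseteq> {z \<in> topspace (prod_topology T Y). (\<lambda>(g, y). act g y) z \<in> U}"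
      by blast
    have ABU: "act h y \<in> U" if "h \<in> A" "y \<in> B" for h y
      using subsetD[OF AB(5), of "(h, y)"] that by simp
    have "openin ?P (A \<times> {F \<in> Exp_set Y. F \<inter> B \<noteq> {}})"
      using AB openin_vietoris_meets[OF AB(2)] by (simp add: openin_prod_Times_iff)
    moreover have "A \<times> {F \<in> Exp_set Y. F \<inter> B \<noteq> {}} \<subseteq> ?f -` {F \<in> Exp_set Y. F \<inter> U \<noteq> {}} \<inter> topspace ?P"
    proof
      fix w assume "w \<in> A \<times> {F \<in> Exp_set Y. F \<inter> B \<noteq> {}}"
      then obtain h E e where hE: "w = (h, E)" "h \<in> A" "E \<in> Exp_set Y" "e \<in> E" "e \<in> B" by blast
      then have "h \<in> topspace T" using AB(1) openin_subset by blast
      moreover have "act h e \<in> U" using hE ABU by blast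
      ultimately show "w \<in> ?f -` {F \<in> Exp_set Y. F \<inter> U \<noteq> {}} \<inter> topspace ?P"
        using hE img by auto
    qed
    ultimately show "\<exists>S. openin ?P S \<and> z \<in> S \<and> S \<subseteq> ?f -` {F \<in> Exp_set Y. F \<inter> U \<noteq> {}} \<inter> topspace ?P"
      using gF AB by blast
  qed
  have "?f ` topspace ?P \<subseteq> Exp_set Y" using img by auto
  then have "?f ` topspace ?P \<subseteq> topspace (vietoris Y)" by simp
  then show ?thesis
    unfolding vietoris_def[of Y] continuous_on_generated_topo_iff topology_generated_by_topspace[symmetric]
    unfolding vietoris_def[of Y, symmetric]
    using sub meet by blast
qed

section \<open>Families of maps to discrete sets\<close>

lemma continuous_map_discrete_iff_fibres:
  "continuous_map Y (discrete_topology UNIV) q \<longleftrightarrow> (\<forall>k. openin Y {y \<in> topspace Y. q y = k})"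
proof
  assume "continuous_map Y (discrete_topology UNIV) q"
  then have "openin Y {y \<in> topspace Y. q y \<in> {k}}" for k
    by (rule openin_continuous_map_preimage) simp
  then show "\<forall>k. openin Y {y \<in> topspace Y. q y = k}" by simp
next
  assume R: "\<forall>k. openin Y {y \<in> topspace Y. q y = k}"
  have "openin Y {y \<in> topspace Y. q y \<in> K}" for K
  proof -
    have "{y \<in> topspace Y. q y \<in> K} = (\<Union>k\<in>K. {y \<in> topspace Y. q y = k})" by blast
    then show ?thesis using R by auto
  qed
  then show "continuous_map Y (discrete_topology UNIV) q" by (simp add: continuous_map_def)
qed

lemma clopen_preimage_discrete:
  assumes "continuous_map Y (discrete_topology UNIV) q"
  shows "openin Y {y \<in> topspace Y. q y \<in> K}" "closedin Y {y \<in> topspace Y. q y \<in> K}"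
  using openin_continuous_map_preimage[OF assms, of K] closedin_continuous_map_preimage[OF assms, of K]
  by simp_all

lemma finite_image_discrete:
  assumes "continuous_map Y (discrete_topology UNIV) q" "compact_space Y"
  shows "finite (q ` topspace Y)"
  using image_compactin[of Y "topspace Y" "discrete_topology UNIV" q] assms
  by (simp add: compact_space_def compactin_discrete_topology)

text \<open>Such a family for \<open>Y\<close> induces one for the Vietoris hyperspace, by taking images under its
  members; so \<open>X\<close>, \<open>Exp(X)\<close> and \<open>Exp(Exp(X))\<close> can be treated alike.\<close>
definition base_maps :: "'b topology \<Rightarrow> ('b \<Rightarrow> 'k) set \<Rightarrow> bool" where
  "base_maps Y Q \<longleftrightarrow>
     (\<forall>q\<in>Q. continuous_map Y (discrete_topology UNIV) q) \<and>
     (\<forall>q1\<in>Q. \<forall>q2\<in>Q. \<exists>q\<in>Q. \<forall>x\<in>topspace Y. \<forall>y\<in>topspace Y.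
        q x = q y \<longrightarrow> q1 x = q1 y \<and> q2 x = q2 y) \<and>
     (\<forall>U y. openin Y U \<and> y \<in> U \<longrightarrow> (\<exists>q\<in>Q. \<forall>x\<in>topspace Y. q x = q y \<longrightarrow> x \<in> U))"

lemma base_maps_continuous: "base_maps Y Q \<Longrightarrow> q \<in> Q \<Longrightarrow> continuous_map Y (discrete_topology UNIV) q"
  unfolding base_maps_def by blast

lemma base_maps_refine:
  assumes "base_maps Y Q" "q1 \<in> Q" "q2 \<in> Q"
  obtains q where "q \<in> Q" "\<And>x y. x \<in> topspace Y \<Longrightarrow> y \<in> topspace Y \<Longrightarrow> q x = q y \<Longrightarrow> q1 x = q1 y \<and> q2 x = q2 y"
proof -
  have "\<exists>q\<in>Q. \<forall>x\<in>topspace Y. \<forall>y\<in>topspace Y. q x = q y \<longrightarrow> q1 x = q1 y \<and> q2 x = q2 y"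
    using assms unfolding base_maps_def by blast
  then show ?thesis using that by blast
qed

lemma base_maps_open:
  assumes "base_maps Y Q" "openin Y U" "y \<in> U"
  obtains q where "q \<in> Q" "\<And>x. x \<in> topspace Y \<Longrightarrow> q x = q y \<Longrightarrow> x \<in> U"
  using assms unfolding base_maps_def by metis

lemma base_maps_refine_finite:
  assumes "base_maps Y Q" "finite R" "R \<subseteq> Q" "Q \<noteq> {}"
  shows "\<exists>q\<in>Q. \<forall>x\<in>topspace Y. \<forall>y\<in>topspace Y. q x = q y \<longrightarrow> (\<forall>r\<in>R. r x = r y)"
  using assms(2,3)
proof (induction rule: finite_induct)
  case empty then show ?case using assms(4) by auto
next
  case (insert r R)
  then obtain q where q: "q \<in> Q" "\<forall>x\<in>topspace Y. \<forall>y\<in>topspace Y. q x = q y \<longrightarrow> (\<forall>r\<in>R. r x = r y)"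
    by auto
  obtain q' where q': "q' \<in> Q"
    "\<And>x y. x \<in> topspace Y \<Longrightarrow> y \<in> topspace Y \<Longrightarrow> q' x = q' y \<Longrightarrow> q x = q y \<and> r x = r y"
    using base_maps_refine[OF assms(1) q(1), of r] insert.prems by auto
  show ?case
  proof (intro bexI[of _ q'] ballI impI)
    fix x y s assume "x \<in> topspace Y" "y \<in> topspace Y" "q' x = q' y" "s \<in> insert r R"
    then show "s x = s y" using q(2) q'(2)[of x y] by blast
  qed (rule q'(1))
qed

text \<open>On \<open>S\<close> the map \<open>r\<close> factors through \<open>q\<close>, so the
  \<open>r\<close>-image of a subset depends only on its \<open>q\<close>-image.\<close>

lemma image_eq_refine:
  assumes "q ` E = q ` F" "E \<subseteq> S" "F \<subseteq> S"
    and "\<And>x y. x \<in> S \<Longrightarrow> y \<in> S \<Longrightarrow> q x = q y \<Longrightarrow> r x = r y"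
  shows "r ` E = r ` F"
proof -
  have "r ` A \<subseteq> r ` B" if AB: "q ` A = q ` B" "A \<subseteq> S" "B \<subseteq> S" for A B
  proof
    fix z assume "z \<in> r ` A"
    then obtain a where a: "a \<in> A" "z = r a" by blast
    then obtain b where b: "b \<in> B" "q a = q b" using AB(1) by blast
    then have "r a = r b" using assms(4) a AB by blast
    then show "z \<in> r ` B" using a b by blast
  qed
  from this[of E F] this[of F E] assms(1-3) show ?thesis by (simp add: subset_antisym)
qed

lemma Exp_set_subset_topspace: "F \<in> Exp_set X \<Longrightarrow> F \<subseteq> topspace X"
  by (auto simp: Exp_set_def dest: closedin_subset)

text \<open>On a compact space \<open>q\<close> has finitely many values, so a fibre of the induced
  map is a finite intersection of subbasic Vietoris sets. Conversely, compactness of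
  \<open>F\<close> allows a single map to control a neighbourhood of \<open>F\<close>.\<close>

lemma base_maps_vietoris:
  assumes Q: "base_maps Y Q" and Y: "compact_space Y"
  shows "base_maps (vietoris Y) ((`) ` Q)"
  unfolding base_maps_def
proof (intro conjI ballI allI impI)
  fix q' assume "q' \<in> (`) ` Q"
  then obtain q where q: "q \<in> Q" "q' = (`) q" by blast
  have fin: "finite (q ` topspace Y)"
    using finite_image_discrete base_maps_continuous[OF Q q(1)] Y by blast
  show "continuous_map (vietoris Y) (discrete_topology UNIV) q'"
    unfolding continuous_map_discrete_iff_fibres topspace_vietoris q(2)
  proof
    fix S
    show "openin (vietoris Y) {E \<in> Exp_set Y. q ` E = S}"
    proof (cases "S \<subseteq> q ` topspace Y \<and> S \<noteq> {}")
      case False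
      then have "{E \<in> Exp_set Y. q ` E = S} = {}"
        using Exp_set_subset_topspace[of _ Y] by (auto simp: Exp_set_def)
      then show ?thesis by (simp only: openin_empty)
    next
      case True
      then have "finite S" using fin finite_subset by blast
      have pre: "openin Y {y \<in> topspace Y. q y \<in> K}" for K
        using clopen_preimage_discrete base_maps_continuous[OF Q q(1)] by blast
      \<comment> \<open>A set has image \<open>S\<close> iff it lies over \<open>S\<close> and meets
        the fibre of each element of \<open>S\<close>.\<close>
      have "{E \<in> Exp_set Y. q ` E = S} =
          {E \<in> Exp_set Y. E \<subseteq> {y \<in> topspace Y. q y \<in> S}} \<inter>
          (\<Inter>s\<in>S. {E \<in> Exp_set Y. E \<inter> {y \<in> topspace Y. q y \<in> {s}} \<noteq> {}})" (is "?L = ?R")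
      proof
        show "?L \<subseteq> ?R" using Exp_set_subset_topspace[of _ Y] by blast
        show "?R \<subseteq> ?L"
        proof
          fix E assume E: "E \<in> ?R"
          then have "q ` E \<subseteq> S" by blast
          moreover have "S \<subseteq> q ` E" using E by blast
          ultimately show "E \<in> ?L" using E by blast
        qed
      qed
      moreover have "openin (vietoris Y) (\<Inter>s\<in>S. {E \<in> Exp_set Y. E \<inter> {y \<in> topspace Y. q y \<in> {s}} \<noteq> {}})"
        using True \<open>finite S\<close> by (intro openin_INT2 openin_vietoris_meets pre) auto
      ultimately show ?thesis
        using openin_vietoris_subset[OF pre[of S]] by (simp only: openin_Int)
    qed
  qed
next
  fix q1' q2' assume "q1' \<in> (`) ` Q" "q2' \<in> (`) ` Q"
  then obtain q1 q2 where q12: "q1 \<in> Q" "q1' = (`) q1" "q2 \<in> Q" "q2' = (`) q2" by blast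
  obtain q where q: "q \<in> Q" 
    "\<And>x y. x \<in> topspace Y \<Longrightarrow> y \<in> topspace Y \<Longrightarrow> q x = q y \<Longrightarrow> q1 x = q1 y \<and> q2 x = q2 y"
    using base_maps_refine[OF Q q12(1,3)] by blast
  have "q1 ` E = q1 ` F \<and> q2 ` E = q2 ` F"
    if "E \<in> Exp_set Y" "F \<in> Exp_set Y" "q ` E = q ` F" for E F
    using image_eq_refine[OF that(3) that(1,2)[THEN Exp_set_subset_topspace], of q1]
      image_eq_refine[OF that(3) that(1,2)[THEN Exp_set_subset_topspace], of q2] q(2) by blast
  then show "\<exists>q'\<in>(`) ` Q. \<forall>E\<in>topspace (vietoris Y). \<forall>F\<in>topspace (vietoris Y).
      q' E = q' F \<longrightarrow> q1' E = q1' F \<and> q2' E = q2' F"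
    unfolding topspace_vietoris q12 using q(1) by blast
next
  fix W F assume WF: "openin (vietoris Y) W \<and> F \<in> W"
  have "\<exists>q\<in>Q. \<forall>E\<in>Exp_set Y. q ` E = q ` F \<longrightarrow> E \<in> W" if "F \<in> W" "F \<in> Exp_set Y"
    using WF[THEN conjunct1, unfolded vietoris_def, THEN openin_topology_generated_by] that(1)
  proof induction
    case (Int a b)
    then obtain q1 q2 where q12: "q1 \<in> Q" "\<forall>E\<in>Exp_set Y. q1 ` E = q1 ` F \<longrightarrow> E \<in> a"
      "q2 \<in> Q" "\<forall>E\<in>Exp_set Y. q2 ` E = q2 ` F \<longrightarrow> E \<in> b"
      by auto
    obtain q where q: "q \<in> Q" 
      "\<And>x y. x \<in> topspace Y \<Longrightarrow> y \<in> topspace Y \<Longrightarrow> q x = q y \<Longrightarrow> q1 x = q1 y \<and> q2 x = q2 y"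
      using base_maps_refine[OF Q q12(1,3)] by blast
    have "E \<in> a \<inter> b" if E: "E \<in> Exp_set Y" "q ` E = q ` F" for E
    proof -
      note sub = Exp_set_subset_topspace[OF E(1)] Exp_set_subset_topspace[OF \<open>F \<in> Exp_set Y\<close>]
      have "q1 ` E = q1 ` F" "q2 ` E = q2 ` F"
        using image_eq_refine[OF E(2) sub, of q1] image_eq_refine[OF E(2) sub, of q2] q(2) by blast+
      then show ?thesis using q12 E by blast
    qed
    then show ?case using q(1) by blast
  next
    case (Basis s)
    then consider U where "openin Y U" "s = {F \<in> Exp_set Y. F \<subseteq> U}"
      | U where "openin Y U" "s = {F \<in> Exp_set Y. F \<inter> U \<noteq> {}}" by blast
    then show ?case
    proof cases
      case 2
      then obtain y where y: "y \<in> F" "y \<in> U" using Basis by blast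
      obtain q where q: "q \<in> Q" "\<And>x. x \<in> topspace Y \<Longrightarrow> q x = q y \<Longrightarrow> x \<in> U"
        using base_maps_open[OF Q 2(1) y(2)] by blast
      have "E \<in> s" if E: "E \<in> Exp_set Y" "q ` E = q ` F" for E
      proof -
        have "q y \<in> q ` E" using y(1) E(2) by blast
        then obtain e where "e \<in> E" "q e = q y" by auto
        then show ?thesis using q(2) Exp_set_subset_topspace[OF E(1)] E(1) 2(2) by auto
      qed
      then show ?thesis using q(1) by blast
    next
      case 1
      then have FU: "F \<subseteq> U" using Basis by blast
      have "\<exists>q. q \<in> Q \<and> (\<forall>x\<in>topspace Y. q x = q y \<longrightarrow> x \<in> U)" if "y \<in> F" for y
        using base_maps_open[OF Q 1(1), of y] FU that by (metis subsetD)
      then obtain r where r: "\<And>y. y \<in> F \<Longrightarrow> r y \<in> Q"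
        "\<And>y x. y \<in> F \<Longrightarrow> x \<in> topspace Y \<Longrightarrow> r y x = r y y \<Longrightarrow> x \<in> U"
        by metis
      \<comment> \<open>\<open>A y\<close> is the fibre of \<open>r y\<close> through
        \<open>y\<close>, contained in \<open>U\<close>. Finitely many of these cover
        \<open>F\<close>, and a common refinement of the corresponding maps keeps every set with the
        same image as \<open>F\<close> inside \<open>U\<close>.\<close>
      define A where "A y = {x \<in> topspace Y. r y x \<in> {r y y}}" for y
      have "\<forall>U\<in>A ` F. openin Y U"
        unfolding A_def
        using clopen_preimage_discrete(1)[OF base_maps_continuous[OF Q r(1)]] by blast
      moreover have "compactin Y F"
        using \<open>F \<in> Exp_set Y\<close> Y closedin_compact_space by (auto simp: Exp_set_def)
      moreover have "F \<subseteq> \<Union>(A ` F)"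
        using Exp_set_subset_topspace[OF \<open>F \<in> Exp_set Y\<close>] by (auto simp: A_def)
      ultimately have "\<exists>\<F>. finite \<F> \<and> \<F> \<subseteq> A ` F \<and> F \<subseteq> \<Union>\<F>"
        unfolding compactin_def by blast
      then obtain \<F> where \<F>: "finite \<F>" "\<F> \<subseteq> A ` F" "F \<subseteq> \<Union>\<F>" by (elim exE conjE)
      from finite_subset_image[OF \<F>(1,2)]
      obtain K where K: "finite K" "K \<subseteq> F" "F \<subseteq> \<Union>(A ` K)"
        using \<F>(3) by blast
      have "F \<noteq> {}" using \<open>F \<in> Exp_set Y\<close> by (auto simp: Exp_set_def)
      then have "Q \<noteq> {}" using r(1) by blast
      have "r ` K \<subseteq> Q" using K r by blast
      then obtain q where q: "q \<in> Q"
        "\<And>x y k. x \<in> topspace Y \<Longrightarrow> y \<in> topspace Y \<Longrightarrow> q x = q y \<Longrightarrow> k \<in> K \<Longrightarrow> r k x = r k y"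
        using base_maps_refine_finite[OF Q finite_imageI[OF K(1)] \<open>r ` K \<subseteq> Q\<close> \<open>Q \<noteq> {}\<close>] by blast
      have "E \<in> s" if E: "E \<in> Exp_set Y" "q ` E = q ` F" for E
      proof -
        have "e \<in> U" if "e \<in> E" for e
        proof -
          have "q e \<in> q ` F" using E(2) that by blast
          then obtain f where f: "f \<in> F" "q e = q f" by auto
          then obtain k where k: "k \<in> K" "f \<in> A k" using K(3) by blast
          have top: "e \<in> topspace Y" "f \<in> topspace Y"
            using that f Exp_set_subset_topspace E(1) \<open>F \<in> Exp_set Y\<close> by blast+
          then have "r k e = r k k" using q(2)[OF top f(2) k(1)] k(2) by (simp add: A_def)
          then show ?thesis using r(2) k K(2) top by blast
        qed
        then show ?thesis using E(1) 1(2) by blast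
      qed
      then show ?thesis using q(1) by blast
    qed
  next
    case (UN K)
    then obtain k where k: "k \<in> K" "F \<in> k" by blast
    then obtain q where "q \<in> Q" "\<forall>E\<in>Exp_set Y. q ` E = q ` F \<longrightarrow> E \<in> k" using UN.IH by blast
    then show ?case using k by blast
  qed simp
  moreover have "W \<subseteq> Exp_set Y" using openin_subset[OF WF[THEN conjunct1]] by simp
  ultimately show "\<exists>q'\<in>(`) ` Q. \<forall>E\<in>topspace (vietoris Y). q' E = q' F \<longrightarrow> E \<in> W"
    using WF by auto
qed

section \<open>Colourings of \<open>X\<close>\<close>

text \<open>Natural numbers as colours serve two purposes: pairs of colours can be coded as colours
  again, and the order of the colours gives a meaning to initial segments.\<close>

definition colourings :: "'a topology \<Rightarrow> ('a \<Rightarrow> nat) set" where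
  "colourings X = {p. continuous_map X (discrete_topology UNIV) p}"

lemma colouring_clopen:
  assumes "p \<in> colourings X"
  shows "openin X {x \<in> topspace X. p x \<in> K}" "closedin X {x \<in> topspace X. p x \<in> K}"
  using clopen_preimage_discrete[of X p K] assms by (auto simp: colourings_def)

lemma colouring_compose: "p \<in> colourings X \<Longrightarrow> (\<lambda>x. h (p x)) \<in> colourings X"
  using continuous_map_compose[of X "discrete_topology UNIV" p "discrete_topology UNIV" h]
  by (simp add: colourings_def o_def)

lemma colouring_if:
  assumes U: "openin X U" "closedin X U" and p: "p \<in> colourings X"
  shows "(\<lambda>x. if x \<in> U then k else p x) \<in> colourings X"
  unfolding colourings_def mem_Collect_eq continuous_map_discrete_iff_fibres
proof
  fix n
  have p': "openin X {y \<in> topspace X. p y = n}"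
    using colouring_clopen(1)[OF p, of "{n}"] by simp
  have "{y \<in> topspace X. (if y \<in> U then k else p y) = n} =
      (if k = n then U \<union> {y \<in> topspace X. p y = n} else {y \<in> topspace X. p y = n} - U)"
    using openin_subset[OF U(1)] by auto
  then show "openin X {y \<in> topspace X. (if y \<in> U then k else p y) = n}"
    using p' U by auto
qed

lemma colouring_const: "(\<lambda>x. k) \<in> colourings X"
  by (simp add: colourings_def)

lemma clopen_base:
  assumes "zero_dimensional X" "openin X W" "x \<in> W"
  obtains U where "openin X U" "closedin X U" "x \<in> U" "U \<subseteq> W"
proof -
  have "\<exists>V U. openin X V \<and> (closedin X U \<and> openin X U) \<and> x \<in> V \<and> V \<subseteq> U \<and> U \<subseteq> W"
    using assms unfolding dimension_le_0_neighbourhood_base_of_clopen neighbourhood_base_of by blast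
  then show ?thesis using that by blast
qed

lemma base_maps_colourings:
  assumes "zero_dimensional X"
  shows "base_maps X (colourings X)"
  unfolding base_maps_def
proof (intro conjI ballI allI impI)
  fix q1 q2 assume q: "q1 \<in> colourings X" "q2 \<in> colourings X"
  show "\<exists>q\<in>colourings X. \<forall>x\<in>topspace X. \<forall>y\<in>topspace X. q x = q y \<longrightarrow> q1 x = q1 y \<and> q2 x = q2 y"
  proof (intro bexI)
    \<comment> \<open>Coding pairs of colours turns the product of two colourings into a common
      refinement with values in \<open>nat\<close>.\<close>
    have "openin X {x \<in> topspace X. prod_encode (q1 x, q2 x) = n}" for n
    proof -
      have "{x \<in> topspace X. prod_encode (q1 x, q2 x) = n} =
          {x \<in> topspace X. q1 x \<in> {fst (prod_decode n)}} \<inter> {x \<in> topspace X. q2 x \<in> {snd (prod_decode n)}}"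
        by auto
      then show ?thesis using q by (simp only:) (intro openin_Int colouring_clopen)
    qed
    then show "(\<lambda>x. prod_encode (q1 x, q2 x)) \<in> colourings X"
      unfolding colourings_def mem_Collect_eq continuous_map_discrete_iff_fibres by blast
  qed auto
next
  fix U y assume "openin X U \<and> y \<in> U"
  then obtain V where V: "openin X V" "closedin X V" "y \<in> V" "V \<subseteq> U"
    using clopen_base[OF assms] by blast
  then show "\<exists>q\<in>colourings X. \<forall>x\<in>topspace X. q x = q y \<longrightarrow> x \<in> U"
    using colouring_if[OF V(1,2) colouring_const[of 0], of 1]
    by (intro bexI[of _ "\<lambda>x. if x \<in> V then 1 else 0"]) auto
qed (simp add: colourings_def)

section \<open>Traces of maximal chains\<close>

text \<open>These are the maximal chains of nonempty subsets of \<open>Q\<close>; for finite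
  \<open>Q\<close> such a chain amounts to a linear order on \<open>Q\<close>. Maximality is phrased
  as membership of every set comparable to all members, which can be checked on traces.\<close>

definition full_chain :: "'k set \<Rightarrow> 'k set set \<Rightarrow> bool" where
  "full_chain Q C \<longleftrightarrow> (\<forall>S\<in>C. S \<subseteq> Q \<and> S \<noteq> {}) \<and> (\<forall>S\<in>C. \<forall>T\<in>C. S \<subseteq> T \<or> T \<subseteq> S) \<and>
     (\<forall>S. S \<subseteq> Q \<and> S \<noteq> {} \<and> (\<forall>T\<in>C. S \<subseteq> T \<or> T \<subseteq> S) \<longrightarrow> S \<in> C)"

lemma full_chain_comparable: "full_chain Q C \<Longrightarrow> S \<in> C \<Longrightarrow> T \<in> C \<Longrightarrow> S \<subseteq> T \<or> T \<subseteq> S"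
  unfolding full_chain_def by blast

lemma full_chain_mem:
  assumes "full_chain Q C" "S \<subseteq> Q" "S \<noteq> {}" "\<And>T. T \<in> C \<Longrightarrow> S \<subseteq> T \<or> T \<subseteq> S"
  shows "S \<in> C"
proof -
  have "\<forall>S. S \<subseteq> Q \<and> S \<noteq> {} \<and> (\<forall>T\<in>C. S \<subseteq> T \<or> T \<subseteq> S) \<longrightarrow> S \<in> C"
    using assms(1) unfolding full_chain_def by (elim conjE)
  then show ?thesis using assms(2-4) by blast
qed

text \<open>Let \<open>T\<close> be the union of the members missing \<open>x\<close>. Then
  \<open>insert x T\<close> is comparable to all members, hence is a member. If no member separated
  \<open>x\<close> from \<open>y\<close>, it would contain \<open>y\<close>, so \<open>y\<close>
  would lie in a member missing \<open>x\<close>.\<close>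

lemma full_chain_separates:
  assumes C: "full_chain Q C" and x: "x \<in> Q" "x \<noteq> y"
  shows "\<exists>S\<in>C. (x \<in> S) \<noteq> (y \<in> S)"
proof (rule ccontr)
  assume "\<not> ?thesis"
  then have same: "x \<in> S \<longleftrightarrow> y \<in> S" if "S \<in> C" for S using that by blast
  have sub: "S \<subseteq> Q" if "S \<in> C" for S using C that unfolding full_chain_def by blast
  have comp: "S \<subseteq> R \<or> R \<subseteq> S" if "S \<in> C" "R \<in> C" for S R
    using C that unfolding full_chain_def by blast
  define T where "T = \<Union>{S \<in> C. x \<notin> S}"
  have "insert x T \<subseteq> S \<or> S \<subseteq> insert x T" if S: "S \<in> C" for S
  proof (cases "x \<in> S")
    case True
    then have "R \<subseteq> S" if "R \<in> C" "x \<notin> R" for R using comp[OF S that(1)] that by blast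
    then show ?thesis using True by (auto simp: T_def)
  qed (use S in \<open>auto simp: T_def\<close>)
  moreover have "insert x T \<subseteq> Q" using x sub by (auto simp: T_def)
  ultimately have "insert x T \<in> C" by (intro full_chain_mem[OF C]) auto
  then have "y \<in> insert x T" using same[of "insert x T"] by simp
  then have "y \<in> T" using x by simp
  then show False using same by (auto simp: T_def)
qed

text \<open>\<open>b x\<close> counts the members that miss \<open>x\<close>: in a chain, an element
  that enters earlier is missed by fewer members. Separation of points makes the count
  injective.\<close>

lemma full_chain_rank:
  assumes C: "full_chain Q C" and Q: "finite Q"
  obtains b :: "'k \<Rightarrow> nat"
  where "inj_on b Q" "\<And>S x y. S \<in> C \<Longrightarrow> x \<in> S \<Longrightarrow> y \<in> Q \<Longrightarrow> b y < b x \<Longrightarrow> y \<in> S"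
proof -
  define b where "b x = card {S \<in> C. x \<notin> S}" for x
  have "C \<subseteq> Pow Q" using C unfolding full_chain_def by blast
  then have fin: "finite C" using Q by (meson finite_Pow_iff finite_subset)
  have comp: "S \<subseteq> R \<or> R \<subseteq> S" if "S \<in> C" "R \<in> C" for S R
    using C that unfolding full_chain_def by blast
  have less: "b x < b y" if "S \<in> C" "x \<in> S" "y \<notin> S" for S x y
    unfolding b_def
  proof (rule psubset_card_mono)
    show "finite {S \<in> C. y \<notin> S}" using fin by simp
    have "y \<notin> R" if "R \<in> C" "x \<notin> R" for R using comp[OF \<open>S \<in> C\<close> that(1)] that \<open>x \<in> S\<close> \<open>y \<notin> S\<close> by blast
    then show "{S \<in> C. x \<notin> S} \<subset> {S \<in> C. y \<notin> S}" using that by blast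
  qed
  show ?thesis
  proof (rule that)
    show "inj_on b Q"
    proof (rule inj_onI, rule ccontr)
      fix x y assume xy: "x \<in> Q" "y \<in> Q" "b x = b y" "x \<noteq> y"
      then obtain S where "S \<in> C" "(x \<in> S) \<noteq> (y \<in> S)" using full_chain_separates[OF C] by blast
      then show False using less[of S x y] less[of S y x] xy(3) by auto
    qed
    show "y \<in> S" if "S \<in> C" "x \<in> S" "b y < b x" for S x y
      using less[of S x y] that by force
  qed
qed

text \<open>Initial segments of a linear order are pairwise comparable, so fullness forces all of
  them into \<open>C\<close>. Such a chain is thus determined by \<open>N\<close>, which is how
  families of traces of different maximal chains are identified later.\<close>

lemma full_chain_initial_segments:
  fixes N :: "'k::linorder set"
  assumes C: "full_chain N C"
    and down: "\<And>S x y. S \<in> C \<Longrightarrow> x \<in> S \<Longrightarrow> y \<in> N \<Longrightarrow> y < x \<Longrightarrow> y \<in> S"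
  shows "C = {S. S \<subseteq> N \<and> S \<noteq> {} \<and> (\<forall>x\<in>S. \<forall>y\<in>N. y < x \<longrightarrow> y \<in> S)}"
proof
  show "C \<subseteq> {S. S \<subseteq> N \<and> S \<noteq> {} \<and> (\<forall>x\<in>S. \<forall>y\<in>N. y < x \<longrightarrow> y \<in> S)}"
    using C down unfolding full_chain_def by blast
  show "{S. S \<subseteq> N \<and> S \<noteq> {} \<and> (\<forall>x\<in>S. \<forall>y\<in>N. y < x \<longrightarrow> y \<in> S)} \<subseteq> C"
  proof clarify
    fix S assume S: "S \<subseteq> N" "S \<noteq> {}" "\<forall>x\<in>S. \<forall>y\<in>N. y < x \<longrightarrow> y \<in> S"
    have "S \<subseteq> T \<or> T \<subseteq> S" if T: "T \<in> C" for T
    proof (rule ccontr)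
      assume "\<not> (S \<subseteq> T \<or> T \<subseteq> S)"
      then obtain s t where st: "s \<in> S" "s \<notin> T" "t \<in> T" "t \<notin> S" by blast
      have "T \<subseteq> N" using C T unfolding full_chain_def by blast
      then show False using st S down[OF T st(3), of s] by (metis linorder_neqE subsetD)
    qed
    then show "S \<in> C" using S by (intro full_chain_mem[OF C])
  qed
qed

section \<open>Maximal chains of closed sets\<close>

lemma maximal_chainD:
  assumes "maximal_chain X c"
  shows "\<And>F. F \<in> c \<Longrightarrow> F \<in> Exp_set X" "\<And>F. F \<in> c \<Longrightarrow> closedin X F"
    "\<And>E F. E \<in> c \<Longrightarrow> F \<in> c \<Longrightarrow> E \<subseteq> F \<or> F \<subseteq> E"
  using assms unfolding maximal_chain_def chain_of_closed_def Exp_set_def by blast+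

lemma maximal_chain_mem:
  assumes "maximal_chain X c" "F \<in> Exp_set X" "\<And>E. E \<in> c \<Longrightarrow> E \<subseteq> F \<or> F \<subseteq> E"
  shows "F \<in> c"
proof -
  have "chain_of_closed X (insert F c)"
    using assms unfolding maximal_chain_def chain_of_closed_def by auto
  then have "insert F c = c" using assms(1) unfolding maximal_chain_def by blast
  then show ?thesis by blast
qed

text \<open>This brings maximality into the form used for \<open>full_chain\<close>, to be verified
  for one closed set at a time.\<close>

lemma maximal_chain_iff:
  "maximal_chain X c \<longleftrightarrow> chain_of_closed X c \<and>
     (\<forall>F\<in>Exp_set X. (\<forall>E\<in>c. E \<subseteq> F \<or> F \<subseteq> E) \<longrightarrow> F \<in> c)"
proof
  assume c: "maximal_chain X c"
  show "chain_of_closed X c \<and> (\<forall>F\<in>Exp_set X. (\<forall>E\<in>c. E \<subseteq> F \<or> F \<subseteq> E) \<longrightarrow> F \<in> c)"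
  proof (intro conjI ballI impI)
    show "chain_of_closed X c" using c unfolding maximal_chain_def by simp
    show "F \<in> c" if "F \<in> Exp_set X" "\<forall>E\<in>c. E \<subseteq> F \<or> F \<subseteq> E" for F
      using that by (intro maximal_chain_mem[OF c]) auto
  qed
next
  assume R: "chain_of_closed X c \<and> (\<forall>F\<in>Exp_set X. (\<forall>E\<in>c. E \<subseteq> F \<or> F \<subseteq> E) \<longrightarrow> F \<in> c)"
  have "d = c" if d: "chain_of_closed X d" "c \<subseteq> d" for d
  proof (rule subset_antisym)
    show "d \<subseteq> c"
    proof
      fix F assume F: "F \<in> d"
      then have "F \<in> Exp_set X" "\<forall>E\<in>c. E \<subseteq> F \<or> F \<subseteq> E"
        using d unfolding chain_of_closed_def by blast+
      then show "F \<in> c" using R by blast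
    qed
  qed (rule d(2))
  then show "maximal_chain X c" using R unfolding maximal_chain_def by blast
qed

lemma topspace_in_maximal_chain:
  assumes "maximal_chain X c" "topspace X \<noteq> {}"
  shows "topspace X \<in> c"
  using assms(2) by (intro maximal_chain_mem[OF assms(1)])
    (auto simp: Exp_set_def dest: maximal_chainD(2)[OF assms(1)] closedin_subset)

lemma maximal_chain_exists: "\<exists>c. maximal_chain X c"
proof -
  obtain c where c: "subset.maxchain (Exp_set X) c"
    using pred_on.Hausdorff[of "Exp_set X" "(\<subset>)"] by blast
  have eq: "chain_of_closed X d \<longleftrightarrow> subset.chain (Exp_set X) d" for d
    unfolding chain_of_closed_def subset_chain_def by blast
  show ?thesis
    using c unfolding pred_on.maxchain_def maximal_chain_def eq by blast
qed

text \<open>Intersecting the members with \<open>P\<close> gives a chain of nonempty closed sets, so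
  each finite intersection is one of them and compactness applies. \<open>P\<close> itself is added
  so that the point lies in \<open>P\<close> even if \<open>c\<close> is empty.\<close>

lemma compact_chain_Inter:
  assumes X: "compact_space X" and P: "closedin X P" "P \<noteq> {}"
    and c: "\<And>F. F \<in> c \<Longrightarrow> closedin X F" "\<And>F. F \<in> c \<Longrightarrow> F \<inter> P \<noteq> {}"
      "\<And>E F. E \<in> c \<Longrightarrow> F \<in> c \<Longrightarrow> E \<subseteq> F \<or> F \<subseteq> E"
  obtains x where "x \<in> P" "\<And>F. F \<in> c \<Longrightarrow> x \<in> F"
proof -
  define \<U> where "\<U> = insert P ((\<lambda>F. F \<inter> P) ` c)"
  have comp: "A \<subseteq> B \<or> B \<subseteq> A" if "A \<in> \<U>" "B \<in> \<U>" for A B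
    using that c(3) unfolding \<U>_def by blast
  have ne: "A \<noteq> {}" if "A \<in> \<U>" for A using that c(2) P unfolding \<U>_def by blast
  have "\<Inter>\<F> \<in> \<F>" if "finite \<F>" "\<F> \<noteq> {}" "\<F> \<subseteq> \<U>" for \<F>
    using that
  proof (induction rule: finite_ne_induct)
    case (insert A \<F>)
    then have "\<Inter>\<F> \<in> \<F>" by blast
    then have "A \<subseteq> \<Inter>\<F> \<or> \<Inter>\<F> \<subseteq> A" using comp[of A "\<Inter>\<F>"] insert.prems by blast
    then have "\<Inter>(insert A \<F>) = A \<or> \<Inter>(insert A \<F>) = \<Inter>\<F>" unfolding Inter_insert by blast
    then show ?case using \<open>\<Inter>\<F> \<in> \<F>\<close> by (metis insertCI)
  qed simp
  then have "\<Inter>\<F> \<noteq> {}" if "finite \<F>" "\<F> \<subseteq> \<U>" for \<F>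
    using that ne by (cases "\<F> = {}") (simp, blast)
  moreover have "closedin X A" if "A \<in> \<U>" for A
    using that P(1) c(1) unfolding \<U>_def by blast
  ultimately have "\<Inter>\<U> \<noteq> {}"
    using X unfolding compact_space_fip by (metis (no_types, lifting))
  then obtain x where "x \<in> \<Inter>\<U>" by blast
  then have "x \<in> A" if "A \<in> \<U>" for A using that by blast
  then show ?thesis by (intro that[of x]) (auto simp: \<U>_def)
qed

text \<open>If \<open>S\<close> were comparable to all traces without being one, the closed set \<open>D\<close> below,
  whose trace is \<open>S\<close>, would be comparable to all members of the chain.\<close>
lemma full_chain_trace:
  assumes c: "maximal_chain X c" and q: "continuous_map X (discrete_topology UNIV) q"
    and X: "compact_space X"
  shows "full_chain (q ` topspace X) ((`) q ` c)"
  unfolding full_chain_def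
proof (intro conjI ballI allI impI)
  fix S assume "S \<in> (`) q ` c"
  then obtain F where F: "F \<in> c" "S = q ` F" by blast
  then show "S \<subseteq> q ` topspace X" "S \<noteq> {}"
    using maximal_chainD(1)[OF c F(1)] Exp_set_subset_topspace[of F X] by (auto simp: Exp_set_def)
next
  fix S T assume "S \<in> (`) q ` c" "T \<in> (`) q ` c"
  then obtain E F where "E \<in> c" "F \<in> c" "S = q ` E" "T = q ` F" by blast
  then show "S \<subseteq> T \<or> T \<subseteq> S" using maximal_chainD(3)[OF c] by (metis image_mono)
next
  fix S assume S: "S \<subseteq> q ` topspace X \<and> S \<noteq> {} \<and> (\<forall>T\<in>(`) q ` c. S \<subseteq> T \<or> T \<subseteq> S)"
  show "S \<in> (`) q ` c"
  proof (rule ccontr)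
    assume nS: "S \<notin> (`) q ` c"
    \<comment> \<open>\<open>c2\<close> consists of the members whose trace includes
      \<open>S\<close>. Intersecting further with the preimage of \<open>S\<close> bounds the trace
      of \<open>D\<close> by \<open>S\<close>.\<close>
    define c2 where "c2 = {F \<in> c. S \<subseteq> q ` F}"
    define D where "D = \<Inter>(insert {x \<in> topspace X. q x \<in> S} c2)"
    have "closedin X D"
      unfolding D_def c2_def
      using clopen_preimage_discrete(2)[OF q] maximal_chainD(2)[OF c] by (intro closedin_Inter) auto
    have qD: "q ` D = S"
    proof
      show "q ` D \<subseteq> S" by (auto simp: D_def)
      show "S \<subseteq> q ` D"
      proof
        fix s assume s: "s \<in> S"
        \<comment> \<open>The fibre of \<open>s\<close> meets every member of \<open>c2\<close>, so
          compactness gives it a point common to all of them, and \<open>s\<close> survives in the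
          trace of \<open>D\<close>.\<close>
        obtain x where "x \<in> {x \<in> topspace X. q x \<in> {s}}" "\<And>F. F \<in> c2 \<Longrightarrow> x \<in> F"
        proof (rule compact_chain_Inter[OF X clopen_preimage_discrete(2)[OF q], of "{s}" c2])
          show "{x \<in> topspace X. q x \<in> {s}} \<noteq> {}" using S s by blast
          show "closedin X F" if "F \<in> c2" for F using that maximal_chainD(2)[OF c] by (simp add: c2_def)
          show "F \<inter> {x \<in> topspace X. q x \<in> {s}} \<noteq> {}" if "F \<in> c2" for F
            using that s maximal_chainD(2)[OF c, of F] closedin_subset[of X F] unfolding c2_def by blast
          show "E \<subseteq> F \<or> F \<subseteq> E" if "E \<in> c2" "F \<in> c2" for E F
            using that maximal_chainD(3)[OF c] by (simp add: c2_def)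
        qed blast
        then have "x \<in> D" "q x = s" using s by (auto simp: D_def)
        then show "s \<in> q ` D" by blast
      qed
    qed
    have "D \<in> c"
    proof (rule maximal_chain_mem[OF c])
      show "D \<in> Exp_set X" using \<open>closedin X D\<close> qD S by (auto simp: Exp_set_def)
      fix E assume E: "E \<in> c"
      show "E \<subseteq> D \<or> D \<subseteq> E"
      proof (cases "S \<subseteq> q ` E")
        case True
        then show ?thesis using E unfolding D_def c2_def by blast
      next
        case False
        then have ES: "q ` E \<subseteq> S" using S E by blast
        \<comment> \<open>A member whose trace does not include \<open>S\<close> cannot contain one
          whose trace does, so it lies below all of \<open>c2\<close>.\<close>
        have "E \<subseteq> F" if F: "F \<in> c2" for F
        proof -
          have "\<not> F \<subseteq> E" using False F by (auto simp: c2_def)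
          then show ?thesis using maximal_chainD(3)[OF c E, of F] F by (simp add: c2_def)
        qed
        moreover have "E \<subseteq> {x \<in> topspace X. q x \<in> S}"
          using ES closedin_subset[OF maximal_chainD(2)[OF c E]] by blast
        ultimately show ?thesis unfolding D_def by blast
      qed
    qed
    then show False using nS qD by blast
  qed
qed

text \<open>A closed set \<open>F\<close> outside \<open>c\<close> is incomparable to some member
  \<open>E\<close>. Omitting a point \<open>y\<close> of \<open>E - F\<close> and meeting the
  complement of \<open>E\<close> is an open condition that preserves this incomparability.\<close>

lemma maximal_chain_closed:
  assumes c: "maximal_chain X c" and X: "Hausdorff_space X" "topspace X \<noteq> {}"
  shows "c \<in> Exp_set (vietoris X)"
proof -
  have "openin (vietoris X) (Exp_set X - c)"
  proof (subst openin_subopen, intro ballI)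
    fix F assume F: "F \<in> Exp_set X - c"
    then obtain E where E: "E \<in> c" "\<not> (E \<subseteq> F \<or> F \<subseteq> E)"
      using maximal_chain_mem[OF c] by blast
    then obtain y where y: "y \<in> E" "y \<notin> F" by blast
    have EX: "closedin X E" "y \<in> topspace X"
      using maximal_chainD(2)[OF c E(1)] closedin_subset y by blast+
    have "closedin X {y}" using closedin_Hausdorff_singleton[OF X(1) EX(2)] .
    then have op: "openin X (topspace X - {y})" by blast
    let ?W = "{A \<in> Exp_set X. A \<subseteq> topspace X - {y}} \<inter> {A \<in> Exp_set X. A \<inter> (topspace X - E) \<noteq> {}}"
    have "openin (vietoris X) ?W"
      using EX op by (intro openin_Int openin_vietoris_subset openin_vietoris_meets) auto
    moreover have "F \<in> ?W"
      using F E y Exp_set_subset_topspace[of F X] by blast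
    moreover have "?W \<subseteq> Exp_set X - c"
      using maximal_chainD(3)[OF c E(1)] y by blast
    ultimately show "\<exists>T. openin (vietoris X) T \<and> F \<in> T \<and> T \<subseteq> Exp_set X - c" by blast
  qed
  then show ?thesis
    using topspace_in_maximal_chain[OF c X(2)] maximal_chainD(1)[OF c]
    by (auto simp: Exp_set_def[of "vietoris X"] closedin_def)
qed

text \<open>Incomparability of two members is witnessed by two points, so a fine enough
  \<open>q\<close> would show it in the traces. A closed set comparable to all members has its trace
  in every family of traces, hence is a limit of members and belongs to the closed set
  \<open>c\<close>.\<close>

lemma maximal_chain_if_traces_full:
  assumes c: "c \<in> Exp_set (vietoris X)" and X: "compact_space X" and Q: "base_maps X Q"
    and full: "\<And>q. q \<in> Q \<Longrightarrow> full_chain (q ` topspace X) ((`) q ` c)"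
  shows "maximal_chain X c"
  unfolding maximal_chain_iff chain_of_closed_def
proof (intro conjI ballI impI)
  have cl: "closedin (vietoris X) c" using c by (simp add: Exp_set_def)
  show cX: "c \<subseteq> Exp_set X" using closedin_subset[OF cl] by simp
  fix E F assume EF: "E \<in> c" "F \<in> c"
  show "E \<subseteq> F \<or> F \<subseteq> E"
  proof (rule ccontr)
    assume "\<not> (E \<subseteq> F \<or> F \<subseteq> E)"
    then obtain x y where xy: "x \<in> E" "x \<notin> F" "y \<in> F" "y \<notin> E" by blast
    have clEF: "closedin X E" "closedin X F" using cX EF by (auto simp: Exp_set_def)
    then have sub: "E \<subseteq> topspace X" "F \<subseteq> topspace X" by (auto dest: closedin_subset)
    obtain q1 where q1: "q1 \<in> Q" "\<And>z. z \<in> topspace X \<Longrightarrow> q1 z = q1 x \<Longrightarrow> z \<in> topspace X - F"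
      using base_maps_open[OF Q, of "topspace X - F" x] clEF xy sub by blast
    obtain q2 where q2: "q2 \<in> Q" "\<And>z. z \<in> topspace X \<Longrightarrow> q2 z = q2 y \<Longrightarrow> z \<in> topspace X - E"
      using base_maps_open[OF Q, of "topspace X - E" y] clEF xy sub by blast
    obtain q where q: "q \<in> Q" 
      "\<And>x y. x \<in> topspace X \<Longrightarrow> y \<in> topspace X \<Longrightarrow> q x = q y \<Longrightarrow> q1 x = q1 y \<and> q2 x = q2 y"
      using base_maps_refine[OF Q q1(1) q2(1)] by blast
    have "q x \<notin> q ` F"
    proof
      assume "q x \<in> q ` F"
      then obtain z where "z \<in> F" "q z = q x" by auto
      then show False using q(2)[of z x] q1(2)[of z] xy sub by blast
    qed
    moreover have "q y \<notin> q ` E"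
    proof
      assume "q y \<in> q ` E"
      then obtain z where "z \<in> E" "q z = q y" by auto
      then show False using q(2)[of z y] q2(2)[of z] xy sub by blast
    qed
    moreover have "q ` E \<subseteq> q ` F \<or> q ` F \<subseteq> q ` E"
      using full_chain_comparable[OF full[OF q(1)]] EF by blast
    ultimately show False using xy by blast
  qed
next
  have cl: "closedin (vietoris X) c" using c by (simp add: Exp_set_def)
  fix F assume F: "F \<in> Exp_set X" "\<forall>E\<in>c. E \<subseteq> F \<or> F \<subseteq> E"
  show "F \<in> c"
  proof (rule ccontr)
    assume "F \<notin> c"
    then have "F \<in> topspace (vietoris X) - c" using F by simp
    moreover have "openin (vietoris X) (topspace (vietoris X) - c)" using cl by blast
    ultimately obtain q' where q': "q' \<in> (`) ` Q"
      "\<And>E. E \<in> topspace (vietoris X) \<Longrightarrow> q' E = q' F \<Longrightarrow> E \<in> topspace (vietoris X) - c"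
      using base_maps_open[OF base_maps_vietoris[OF Q X], of "topspace (vietoris X) - c" F] by blast
    then obtain q where q: "q \<in> Q" "q' = (`) q" by blast
    have FX: "q ` F \<subseteq> q ` topspace X" "q ` F \<noteq> {}"
      using F(1) Exp_set_subset_topspace[of F X] by (auto simp: Exp_set_def)
    have "\<forall>T\<in>(`) q ` c. q ` F \<subseteq> T \<or> T \<subseteq> q ` F" using F(2) by blast
    then have "q ` F \<in> (`) q ` c"
      by (intro full_chain_mem[OF full[OF q(1)] FX]) blast
    then obtain E where "E \<in> c" "q ` E = q ` F" by auto
    then show False using q'(2)[of E] closedin_subset[OF cl] q(2) by blast
  qed
qed

section \<open>The space of maximal chains\<close>

text \<open>A point of the second hyperspace fails to be a maximal chain exactly if, for some
  colouring, its family of traces is not full. For each colouring this is a condition on a locally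
  constant value, hence open.\<close>

lemma
  assumes X: "zero_dimensional X" "compact_space X" "Hausdorff_space X" "topspace X \<noteq> {}"
  shows topspace_Phi: "topspace (Phi X) = {c. maximal_chain X c}"
    and closedin_maximal_chains: "closedin (vietoris (vietoris X)) {c. maximal_chain X c}"
proof -
  have sub: "{c. maximal_chain X c} \<subseteq> Exp_set (vietoris X)"
    using maximal_chain_closed X by blast
  then show "topspace (Phi X) = {c. maximal_chain X c}"
    unfolding Phi_def by auto
  let ?V = "vietoris (vietoris X)"
  note Q = base_maps_colourings[OF X(1)]
  have QQ: "base_maps ?V ((`) ` (`) ` colourings X)"
    using base_maps_vietoris[OF base_maps_vietoris[OF Q X(2)] compact_space_vietoris[OF X(2)]] .
  have eq: "topspace ?V - {c. maximal_chain X c} =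
     (\<Union>q\<in>colourings X. {c \<in> topspace ?V. (`) q ` c \<in> {C. \<not> full_chain (q ` topspace X) C}})"
    using maximal_chain_if_traces_full[OF _ X(2) Q] full_chain_trace[OF _ base_maps_continuous[OF Q] X(2)]
    by auto
  have "openin ?V {c \<in> topspace ?V. (`) q ` c \<in> {C. \<not> full_chain (q ` topspace X) C}}"
    if "q \<in> colourings X" for q
    using clopen_preimage_discrete(1)[OF base_maps_continuous[OF QQ]] that by blast
  then have "openin ?V (topspace ?V - {c. maximal_chain X c})"
    unfolding eq by blast
  then show "closedin ?V {c. maximal_chain X c}"
    using sub unfolding closedin_def by simp
qed

lemma compact_Hausdorff_Phi:
  assumes X: "zero_dimensional X" "compact_space X" "Hausdorff_space X" "topspace X \<noteq> {}"
  shows "compact_space (Phi X)" "Hausdorff_space (Phi X)"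
proof -
  have V: "compact_space (vietoris X)" "Hausdorff_space (vietoris X)"
    using X compact_space_vietoris Hausdorff_space_vietoris compact_Hausdorff_imp_regular_space by blast+
  then have VV: "compact_space (vietoris (vietoris X))" "Hausdorff_space (vietoris (vietoris X))"
    using compact_space_vietoris Hausdorff_space_vietoris compact_Hausdorff_imp_regular_space by blast+
  show "Hausdorff_space (Phi X)"
    unfolding Phi_def using VV(2) Hausdorff_space_subtopology by blast
  show "compact_space (Phi X)"
    unfolding Phi_def
    using VV(1) closedin_maximal_chains[OF X] by (intro compact_space_subtopology closedin_compact_space)
qed

text \<open>Approximating \<open>d\<close> in \<Phi>(X) thus amounts to matching the traces of a
  single colouring; minimality and proximality of \<Phi>(X) are both obtained through this form of
  neighbourhoods.\<close>

lemma Phi_neighbourhood: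
  assumes X: "zero_dimensional X" "compact_space X" "Hausdorff_space X" "topspace X \<noteq> {}"
    and W: "openin (Phi X) W" "d \<in> W"
  shows "\<exists>q\<in>colourings X. \<forall>c. maximal_chain X c \<and> (`) q ` c = (`) q ` d \<longrightarrow> c \<in> W"
proof -
  let ?V = "vietoris (vietoris X)"
  have QQ: "base_maps ?V ((`) ` (`) ` colourings X)"
    using base_maps_vietoris[OF base_maps_vietoris[OF base_maps_colourings[OF X(1)] X(2)]
        compact_space_vietoris[OF X(2)]] .
  obtain O' where O': "openin ?V O'" "W = O' \<inter> {c. maximal_chain X c}"
    using W(1) unfolding Phi_def openin_subtopology by blast
  then have "d \<in> O'" using W(2) by blast
  then obtain q' where q': "q' \<in> (`) ` (`) ` colourings X"
    "\<And>c. c \<in> topspace ?V \<Longrightarrow> q' c = q' d \<Longrightarrow> c \<in> O'"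
    using base_maps_open[OF QQ O'(1)] by blast
  then obtain q where q: "q \<in> colourings X" "q' = (`) ((`) q)" by blast
  show ?thesis
  proof (intro bexI[OF _ q(1)] allI impI, elim conjE)
    fix c assume c: "maximal_chain X c" "(`) q ` c = (`) q ` d"
    then show "c \<in> W"
      using q'(2)[of c] maximal_chain_closed[OF c(1) X(3,4)] by (simp add: O'(2) q(2))
  qed
qed

section \<open>Homeomorphisms and colourings\<close>

lemma
  assumes "g \<in> Homeo X"
  shows Homeo_image: "g ` topspace X = topspace X"
    and Homeo_inj_on: "inj_on g (topspace X)"
    and Homeo_continuous: "continuous_map X X g"
    and Homeo_closed_map: "closed_map X X g"
proof -
  have h: "homeomorphic_map X X g" using assms by (simp add: Homeo_def)
  then show "g ` topspace X = topspace X" by (rule homeomorphic_imp_surjective_map)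
  show "inj_on g (topspace X)" using h by (rule homeomorphic_imp_injective_map)
  show "continuous_map X X g" using h by (rule homeomorphic_imp_continuous_map)
  show "closed_map X X g" using h by (rule homeomorphic_imp_closed_map)
qed

lemma id_in_Homeo: "id \<in> Homeo X"
  by (simp add: Homeo_def)

lemma Homeo_image_Exp_set: "g \<in> Homeo X \<Longrightarrow> F \<in> Exp_set X \<Longrightarrow> g ` F \<in> Exp_set X"
  using Homeo_closed_map[of g X] by (auto simp: Exp_set_def closed_map_def)

lemma maximal_chain_Phi_act:
  assumes g: "g \<in> Homeo X" and c: "maximal_chain X c"
  shows "maximal_chain X (Phi_act g c)"
  unfolding maximal_chain_iff chain_of_closed_def
proof (intro conjI ballI impI)
  show "Phi_act g c \<subseteq> Exp_set X"
    using Homeo_image_Exp_set[OF g] maximal_chainD(1)[OF c] by (auto simp: Phi_act_def)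
next
  fix A B assume "A \<in> Phi_act g c" "B \<in> Phi_act g c"
  then obtain E F where "E \<in> c" "F \<in> c" "A = g ` E" "B = g ` F" by (auto simp: Phi_act_def)
  then show "A \<subseteq> B \<or> B \<subseteq> A" using maximal_chainD(3)[OF c] by (metis image_mono)
next
  fix A assume A: "A \<in> Exp_set X" "\<forall>E\<in>Phi_act g c. E \<subseteq> A \<or> A \<subseteq> E"
  \<comment> \<open>The candidate is pulled back along \<open>g\<close>; injectivity of
    \<open>g\<close> on \<open>X\<close> turns its comparability to the images into comparability of
    \<open>B\<close> to the members of \<open>c\<close>.\<close>
  define B where "B = {x \<in> topspace X. g x \<in> A}"
  have gB: "g ` B = A"
    using Exp_set_subset_topspace[OF A(1)] Homeo_image[OF g] unfolding B_def by (auto simp: image_iff)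
  have "closedin X B"
    unfolding B_def using closedin_continuous_map_preimage[OF Homeo_continuous[OF g]] A(1)
    by (simp add: Exp_set_def)
  then have "B \<in> Exp_set X" using gB A(1) by (auto simp: Exp_set_def)
  moreover have "E \<subseteq> B \<or> B \<subseteq> E" if E: "E \<in> c" for E
  proof -
    have EX: "E \<subseteq> topspace X" using maximal_chainD(1)[OF c E] by (rule Exp_set_subset_topspace)
    have "g ` E \<subseteq> g ` B \<or> g ` B \<subseteq> g ` E" using A(2) E gB by (auto simp: Phi_act_def)
    moreover have "B \<subseteq> topspace X" by (auto simp: B_def)
    ultimately show ?thesis using inj_on_image_subset_iff[OF Homeo_inj_on[OF g]] EX by blast
  qed
  ultimately have "B \<in> c" by (intro maximal_chain_mem[OF c]) auto
  then show "A \<in> Phi_act g c" using gB by (auto simp: Phi_act_def)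
qed

text \<open>The homeomorphism is glued from homeomorphisms between fibres of equal colour, all of
  which are homeomorphic to \<open>X\<close>.\<close>
lemma Homeo_matching_colourings:
  assumes h: "h_homogeneous X" and X: "compact_space X" "Hausdorff_space X"
    and p: "p \<in> colourings X" and q: "q \<in> colourings X"
    and pq: "p ` topspace X = q ` topspace X"
  shows "\<exists>g\<in>Homeo X. (\<forall>x\<in>topspace X. q (g x) = p x) \<and>
    (\<forall>x\<in>topspace X. {y \<in> topspace X. p y = p x} = {y \<in> topspace X. q y = p x} \<longrightarrow> g x = x)"
proof -
  define P where "P n = {x \<in> topspace X. p x \<in> {n}}" for n
  define R where "R n = {x \<in> topspace X. q x \<in> {n}}" for n
  have sub: "P n \<subseteq> topspace X" "R n \<subseteq> topspace X" for n by (auto simp: P_def R_def)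
  have clop: "clopenin X (P n)" "clopenin X (R n)" for n
    unfolding P_def R_def clopenin_def by (intro conjI colouring_clopen p q)+
  \<comment> \<open>Where the two fibres coincide, the identity is chosen; this control over fixed
    points later provides elements of the stabiliser of a point.\<close>
  have "\<exists>f. homeomorphic_map (subtopology X (P n)) (subtopology X (R n)) f \<and>
      (P n = R n \<longrightarrow> f = id)" if n: "n \<in> p ` topspace X" for n
  proof (cases "P n = R n")
    case True then show ?thesis by (intro exI[of _ id]) simp
  next
    case False
    have "P n \<noteq> {}" using n by (auto simp: P_def)
    moreover have "R n \<noteq> {}" using n unfolding pq by (auto simp: R_def)
    ultimately have "subtopology X (P n) homeomorphic_space X" "subtopology X (R n) homeomorphic_space X"
      using h clop unfolding h_homogeneous_def by blast+
    then have "subtopology X (P n) homeomorphic_space subtopology X (R n)"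
      using homeomorphic_space_sym homeomorphic_space_trans by blast
    then show ?thesis using False by (auto simp: homeomorphic_space)
  qed
  then obtain f where f: "\<And>n. n \<in> p ` topspace X \<Longrightarrow>
      homeomorphic_map (subtopology X (P n)) (subtopology X (R n)) (f n)"
      "\<And>n. n \<in> p ` topspace X \<Longrightarrow> P n = R n \<Longrightarrow> f n = id" by metis
  have fim: "f n ` P n = R n" and finj: "inj_on (f n) (P n)"
    and fcont: "continuous_map (subtopology X (P n)) X (f n)" if "n \<in> p ` topspace X" for n
  proof -
    have top: "topspace (subtopology X (P n)) = P n" "topspace (subtopology X (R n)) = R n"
      using sub[of n] by auto
    show "f n ` P n = R n" using homeomorphic_imp_surjective_map[OF f(1)[OF that]] top by simp
    show "inj_on (f n) (P n)" using homeomorphic_imp_injective_map[OF f(1)[OF that]] top by simp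
    show "continuous_map (subtopology X (P n)) X (f n)"
      using homeomorphic_imp_continuous_map[OF f(1)[OF that]] continuous_map_into_fulltopology by blast
  qed
  define g where "g x = (if x \<in> topspace X then f (p x) x else x)" for x
  have gR: "g x \<in> R (p x)" if "x \<in> topspace X" for x
    using fim[of "p x"] that unfolding g_def P_def by auto
  then have qg: "q (g x) = p x" "g x \<in> topspace X" if "x \<in> topspace X" for x
    using that by (auto simp: R_def)
  have "homeomorphic_map X X g"
  \<comment> \<open>A continuous bijection of a compact Hausdorff space is a homeomorphism, and
    continuity can be checked on the open fibres of \<open>p\<close>.\<close>
  proof (rule continuous_imp_homeomorphic_map)
    show "continuous_map X X g"
      unfolding continuous_map_def
    proof (intro conjI allI impI)
      show "g \<in> topspace X \<rightarrow> topspace X" using qg by blast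
      fix U assume U: "openin X U"
      have "{x \<in> topspace X. g x \<in> U} =
          (\<Union>n\<in>p ` topspace X. {x \<in> topspace (subtopology X (P n)). f n x \<in> U})"
        using sub by (auto simp: g_def P_def)
      moreover have "openin X {x \<in> topspace (subtopology X (P n)). f n x \<in> U}"
        if "n \<in> p ` topspace X" for n
        using openin_continuous_map_preimage[OF fcont[OF that] U] clop(1)[of n]
        by (simp add: clopenin_def openin_open_subtopology)
      ultimately show "openin X {x \<in> topspace X. g x \<in> U}" by auto
    qed
    show "g ` topspace X = topspace X"
    proof
      show "g ` topspace X \<subseteq> topspace X" using qg by blast
      show "topspace X \<subseteq> g ` topspace X"
      proof
        fix y assume y: "y \<in> topspace X"
        then have n: "q y \<in> p ` topspace X" using pq by blast
        have "y \<in> R (q y)" using y by (simp add: R_def)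
        then obtain x where "x \<in> P (q y)" "y = f (q y) x" using fim[OF n] by blast
        then have "x \<in> topspace X" "y = g x" by (auto simp: g_def P_def)
        then show "y \<in> g ` topspace X" by blast
      qed
    qed
    show "inj_on g (topspace X)"
    proof (rule inj_onI)
      fix x y assume xy: "x \<in> topspace X" "y \<in> topspace X" "g x = g y"
      then have "p x = p y" using qg(1) by metis
      then have "f (p x) x = f (p x) y" "x \<in> P (p x)" "y \<in> P (p x)"
        using xy by (auto simp: g_def P_def)
      then show "x = y" using finj[of "p x"] xy(1) by (auto dest: inj_onD)
    qed
  qed (use X in auto)
  then have "g \<in> Homeo X" by (simp add: Homeo_def g_def)
  moreover have "g x = x" if "x \<in> topspace X"
    "{y \<in> topspace X. p y = p x} = {y \<in> topspace X. q y = p x}" for x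
    using f(2)[of "p x"] that by (simp add: g_def P_def R_def)
  ultimately show ?thesis using qg(1) by blast
qed

text \<open>Ensures that every nonempty fibre of a colouring has room to be split further.\<close>

lemma infinite_clopen:
  assumes "h_homogeneous X" "infinite (topspace X)" "openin X U" "closedin X U" "U \<noteq> {}"
  shows "infinite U"
proof
  assume U: "finite U"
  have "subtopology X U homeomorphic_space X"
    using assms unfolding h_homogeneous_def clopenin_def by blast
  then obtain f where "homeomorphic_map (subtopology X U) X f" by (auto simp: homeomorphic_space)
  then have "f ` topspace (subtopology X U) = topspace X" by (rule homeomorphic_imp_surjective_map)
  then have "finite (topspace X)" using U by (metis finite_Int finite_imageI topspace_subtopology)
  then show False using assms(2) by simp
qed

text \<open>The fibre of the largest colour is split so that the part keeping its colour contains, for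
  each of the two chains, a point common to all members that meet the fibre.\<close>
lemma initial_segment_colouring:
  assumes h: "h_homogeneous X" and inf: "infinite (topspace X)"
    and X: "zero_dimensional X" "compact_space X" "Hausdorff_space X"
    and c: "maximal_chain X c1" "maximal_chain X c2"
    and N: "finite N" "N \<noteq> {}"
  shows "\<exists>p\<in>colourings X. p ` topspace X = N \<and>
    (\<forall>F\<in>c1 \<union> c2. \<forall>x\<in>p ` F. \<forall>y\<in>N. y < x \<longrightarrow> y \<in> p ` F)"
  using N
proof (induction rule: finite_linorder_max_induct)
  case (insert b A)
  show ?case
  proof (cases "A = {}")
    case True
    moreover have "(\<lambda>x. b) ` topspace X = {b}" using inf by (auto simp: image_constant_conv)
    ultimately show ?thesis
      using colouring_const[of b X] by (intro bexI[of _ "\<lambda>x. b"]) auto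
  next
    case False
    then obtain p where p: "p \<in> colourings X" "p ` topspace X = A"
      and down: "\<And>F x y. F \<in> c1 \<union> c2 \<Longrightarrow> x \<in> p ` F \<Longrightarrow> y \<in> A \<Longrightarrow> y < x \<Longrightarrow> y \<in> p ` F"
      using insert.IH by blast
    define m where "m = Max A"
    have m: "m \<in> A" "\<And>a. a \<in> A \<Longrightarrow> a \<le> m" using False insert.hyps(1) by (auto simp: m_def)
    define P where "P = {x \<in> topspace X. p x \<in> {m}}"
    have P: "openin X P" "closedin X P" unfolding P_def by (intro colouring_clopen p)+
    have Pne: "P \<noteq> {}" using m(1) p(2) unfolding P_def by blast
    have root: "\<exists>x\<in>P. \<forall>F\<in>c. F \<inter> P \<noteq> {} \<longrightarrow> x \<in> F" if c: "maximal_chain X c" for c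
    proof -
      obtain x where "x \<in> P" "\<And>F. F \<in> {F \<in> c. F \<inter> P \<noteq> {}} \<Longrightarrow> x \<in> F"
        by (rule compact_chain_Inter[OF X(2) P(2) Pne, of "{F \<in> c. F \<inter> P \<noteq> {}}"])
          (use maximal_chainD[OF c] in auto)
      then show ?thesis by blast
    qed
    from root[OF c(1)] obtain x1 where x1: "x1 \<in> P" "\<forall>F\<in>c1. F \<inter> P \<noteq> {} \<longrightarrow> x1 \<in> F" ..
    from root[OF c(2)] obtain x2 where x2: "x2 \<in> P" "\<forall>F\<in>c2. F \<inter> P \<noteq> {} \<longrightarrow> x2 \<in> F" ..
    note x12 = x1(1) x2(1) x1(2)[rule_format] x2(2)[rule_format]
    \<comment> \<open>The infinite fibre has a point \<open>z\<close> besides \<open>x1\<close> and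
      \<open>x2\<close>; a clopen set around \<open>z\<close> that avoids both receives the new
      largest colour \<open>b\<close>.\<close>
    have "infinite (P - {x1, x2})" using infinite_clopen[OF h inf P Pne] by simp
    then obtain z where z: "z \<in> P - {x1, x2}" by (metis ex_in_conv finite.emptyI)
    have "{x1, x2} \<subseteq> topspace X" using x12 by (auto simp: P_def)
    then have "closedin X {x1, x2}"
      using X(3) by (simp add: closedin_Hausdorff_finite)
    then have "openin X (P - {x1, x2})" using P(1) by blast
    then obtain V where V: "openin X V" "closedin X V" "z \<in> V" "V \<subseteq> P - {x1, x2}"
      using clopen_base[OF X(1) _ z] by blast
    define p' where "p' x = (if x \<in> V then b else p x)" for x
    have p': "p' \<in> colourings X" unfolding p'_def using colouring_if[OF V(1,2) p(1)] .
    have VP: "p x = m" if "x \<in> V" for x using V(4) that by (auto simp: P_def)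
    have "p' ` topspace X = insert b A"
    proof
      show "p' ` topspace X \<subseteq> insert b A" using p(2) by (auto simp: p'_def)
      have "a \<in> p' ` topspace X" if a: "a \<in> A" for a
      proof (cases "a = m")
        case True
        have "p' x1 = m" "x1 \<in> topspace X" using x12(1) V(4) by (auto simp: p'_def P_def)
        then show ?thesis using True by blast
      next
        case False
        obtain x where x: "x \<in> topspace X" "a = p x" using a p(2) by blast
        then have "x \<notin> V" using VP False by blast
        then show ?thesis using x by (auto simp: p'_def)
      qed
      moreover have "b \<in> p' ` topspace X"
        using V(3) openin_subset[OF V(1)] by (force simp: p'_def)
      ultimately show "insert b A \<subseteq> p' ` topspace X" by blast
    qed
    moreover have "y \<in> p' ` F" if F: "F \<in> c1 \<union> c2" and x: "x \<in> p' ` F" and y: "y \<in> insert b A" "y < x" for F x y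
    proof -
      obtain f where f: "f \<in> F" "x = p' f" using x by blast
      have FX: "F \<subseteq> topspace X"
        using F maximal_chainD(1)[OF c(1)] maximal_chainD(1)[OF c(2)] Exp_set_subset_topspace by blast
      have pf: "p f \<in> A" using f FX p(2) by blast
      have "x \<le> b" using f pf insert.hyps(2) by (auto simp: p'_def intro: less_imp_le)
      then have yA: "y \<in> A" using y by auto
      show ?thesis
      \<comment> \<open>The new colour adds one demand: a member meeting \<open>V\<close> must still
        show the colour \<open>m\<close>. Such a member meets \<open>P\<close>, so it contains
        \<open>x1\<close> or \<open>x2\<close>, which kept that colour.\<close>
      proof (cases "f \<in> V \<and> y = m")
        case True
        then have "F \<inter> P \<noteq> {}" using f V(4) by blast
        then obtain w where w: "w \<in> F" "w = x1 \<or> w = x2" using F x12 by blast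
        then have "p' w = m" using x12(1,2) V(4) by (auto simp: p'_def P_def)
        then show ?thesis using w True by blast
      next
        case False
        \<comment> \<open>Otherwise \<open>y\<close> is below the old colour of \<open>f\<close> and
          differs from \<open>m\<close>. The induction hypothesis gives a point of \<open>F\<close>
          with old colour \<open>y\<close>; it lies outside \<open>V\<close>, where the old colour
          is \<open>m\<close>, so it keeps its colour.\<close>
        have "y < p f" "y \<noteq> m"
        proof -
          show "y \<noteq> m" using False f(2) y(2) m(2)[OF pf] by (auto simp: p'_def)
          then show "y < p f" using f(2) y(2) VP m(2)[OF yA] by (auto simp: p'_def split: if_splits)
        qed
        then have "y \<in> p ` F" using down[OF F _ yA] f(1) by blast
        then obtain e where e: "e \<in> F" "y = p e" by blast
        then have "e \<notin> V" using VP \<open>y \<noteq> m\<close> by blast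
        then show ?thesis using e by (auto simp: p'_def)
      qed
    qed
    ultimately show ?thesis using p' by (intro bexI[of _ p']) auto
  qed
qed simp

text \<open>Relabel the colours of \<open>q\<close> so that the traces of \<open>d\<close> become
  initial segments, and choose \<open>p\<close> with the same colours for which \<open>c1\<close>
  and \<open>c2\<close> both have all initial segments as traces. A homeomorphism matching
  \<open>p\<close> with the relabelled \<open>q\<close> moves both chains at once, as proximality
  demands.\<close>

lemma Homeo_match_traces:
  assumes h: "h_homogeneous X" and inf: "infinite (topspace X)"
    and X: "zero_dimensional X" "compact_space X" "Hausdorff_space X"
    and c: "maximal_chain X c1" "maximal_chain X c2" and d: "maximal_chain X d"
    and q: "q \<in> colourings X"
  shows "\<exists>g\<in>Homeo X. (`) q ` Phi_act g c1 = (`) q ` d \<and> (`) q ` Phi_act g c2 = (`) q ` d"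
proof -
  have cont: "continuous_map X (discrete_topology UNIV) r" if "r \<in> colourings X" for r
    using that by (simp add: colourings_def)
  have finQ: "finite (q ` topspace X)" using finite_image_discrete[OF cont[OF q] X(2)] .
  \<comment> \<open>\<open>b\<close> numbers the colours in the order in which they enter the traces
    of \<open>d\<close>.\<close>
  obtain b :: "nat \<Rightarrow> nat" where b: "inj_on b (q ` topspace X)"
    "\<And>S x y. S \<in> (`) q ` d \<Longrightarrow> x \<in> S \<Longrightarrow> y \<in> q ` topspace X \<Longrightarrow> b y < b x \<Longrightarrow> y \<in> S"
    using full_chain_rank[OF full_chain_trace[OF d cont[OF q] X(2)] finQ] by blast
  define r where "r x = b (q x)" for x
  have r: "r \<in> colourings X" unfolding r_def using colouring_compose[OF q] .
  define N where "N = r ` topspace X"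
  have N: "finite N" "N \<noteq> {}"
    using finite_image_discrete[OF cont[OF r] X(2)] inf by (auto simp: N_def)
  from initial_segment_colouring[OF h inf X c N]
  obtain p where p: "p \<in> colourings X" "p ` topspace X = N"
    and down: "\<forall>F\<in>c1 \<union> c2. \<forall>x\<in>p ` F. \<forall>y\<in>N. y < x \<longrightarrow> y \<in> p ` F"
    by (elim bexE conjE)
  have "p ` topspace X = r ` topspace X" using p(2) N_def by simp
  from Homeo_matching_colourings[OF h X(2,3) p(1) r this]
  obtain g where g: "g \<in> Homeo X" "\<forall>x\<in>topspace X. r (g x) = p x"
    by (elim bexE conjE)
  have "(`) r ` d = {S. S \<subseteq> N \<and> S \<noteq> {} \<and> (\<forall>x\<in>S. \<forall>y\<in>N. y < x \<longrightarrow> y \<in> S)}"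
  proof (rule full_chain_initial_segments)
    show "full_chain N ((`) r ` d)" unfolding N_def by (rule full_chain_trace[OF d cont[OF r] X(2)])
    fix S x y assume S: "S \<in> (`) r ` d" and x: "x \<in> S" and y: "y \<in> N" "y < x"
    obtain F where F: "F \<in> d" "S = r ` F" using S by blast
    obtain f where f: "f \<in> F" "x = b (q f)" using x F by (auto simp: r_def)
    obtain z where z: "z \<in> topspace X" "y = b (q z)" using y by (auto simp: r_def N_def)
    have "q z \<in> q ` F" using b(2)[of "q ` F" "q f" "q z"] F f z y by blast
    then show "y \<in> S" using F z by (auto simp: r_def)
  qed
  moreover have "(`) p ` e = {S. S \<subseteq> N \<and> S \<noteq> {} \<and> (\<forall>x\<in>S. \<forall>y\<in>N. y < x \<longrightarrow> y \<in> S)}"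
    if e: "maximal_chain X e" "e \<subseteq> c1 \<union> c2" for e
  proof (rule full_chain_initial_segments)
    show "full_chain N ((`) p ` e)"
      using full_chain_trace[OF e(1) cont[OF p(1)] X(2)] p(2) by simp
    fix S x y assume S: "S \<in> (`) p ` e" and "x \<in> S" "y \<in> N" "y < x"
    then show "y \<in> S" using down e(2) by blast
  qed
  ultimately have pr: "(`) p ` e = (`) r ` d" if "maximal_chain X e" "e \<subseteq> c1 \<union> c2" for e
    using that by simp
  have "(`) q ` Phi_act g e = (`) q ` d" if e: "maximal_chain X e" "e \<subseteq> c1 \<union> c2" for e
  proof -
    have rg: "r ` (g ` F) = p ` F" if "F \<in> e" for F
    proof -
      have "F \<subseteq> topspace X" using maximal_chainD(1)[OF e(1) that] by (rule Exp_set_subset_topspace)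
      then show ?thesis using g(2) by (force simp: image_image)
    qed
    have "(`) r ` Phi_act g e = (`) p ` e"
      unfolding Phi_act_def image_image[of "(`) r"] by (rule image_cong[OF refl rg])
    then have "(`) r ` Phi_act g e = (`) r ` d" using pr[OF e] by simp
    moreover have "(`) r ` e' = (`) b ` ((`) q ` e')" for e'
      unfolding r_def by (simp add: image_image)
    ultimately have b_eq: "(`) b ` ((`) q ` Phi_act g e) = (`) b ` ((`) q ` d)" by simp
    have sub: "(`) q ` e' \<subseteq> Pow (q ` topspace X)" if "maximal_chain X e'" for e'
      using maximal_chainD(1)[OF that] Exp_set_subset_topspace[of _ X] by blast
    show ?thesis
      by (rule inj_on_image_eq_iff[OF inj_on_image_Pow[OF b(1)], THEN iffD1,
            OF sub[OF maximal_chain_Phi_act[OF g(1) e(1)]] sub[OF d] b_eq])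
  qed
  then show ?thesis using g(1) c by blast
qed

section \<open>Dynamics of \<open>X\<close> and of \<open>\<Phi>(X)\<close>\<close>

text \<open>The filter is generated by the preimages under \<open>\<phi>\<close> of neighbourhoods
  of \<open>z\<close>, restricted to \<open>G\<close>; the assumption \<open>near\<close> makes it
  proper.\<close>

lemma net_exists:
  assumes z: "z \<in> topspace Y" and near: "\<And>W. openin Y W \<Longrightarrow> z \<in> W \<Longrightarrow> \<exists>g\<in>G. \<phi> g \<in> W"
  obtains N where "net_in G N" "limitin Y \<phi> z N"
proof -
  define N where "N = inf (filtercomap \<phi> (nhdsin Y z)) (principal G)"
  have nhd: "eventually R N" if "openin Y W" "z \<in> W" "\<forall>g\<in>G. \<phi> g \<in> W \<longrightarrow> R g" for R W
    unfolding N_def eventually_inf_principal eventually_filtercomap eventually_nhdsin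
    by (rule exI[of _ "\<lambda>y. y \<in> W"]) (use that in auto)
  have "N \<noteq> bot"
  proof
    assume "N = bot"
    then have "eventually (\<lambda>_. False) N" by simp
    then obtain Q where Q: "eventually Q (nhdsin Y z)" "\<forall>g. Q (\<phi> g) \<longrightarrow> g \<notin> G"
      unfolding N_def eventually_inf_principal eventually_filtercomap by auto
    then obtain W where "openin Y W" "z \<in> W" "\<forall>y\<in>W. Q y"
      using z unfolding eventually_nhdsin by auto
    then show False using near[of W] Q(2) by blast
  qed
  moreover have "eventually (\<lambda>g. g \<in> G) N"
    by (rule nhd[OF openin_topspace z]) simp
  ultimately have "net_in G N" by (simp add: net_in_def)
  moreover have "limitin Y \<phi> z N"
    unfolding limitin_def using z by (auto intro: nhd)
  ultimately show ?thesis by (rule that)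
qed

text \<open>Take a clopen \<open>A\<close> missing \<open>F\<close> and a clopen \<open>B\<close>
  inside \<open>V\<close>. A homeomorphism that carries the complement of \<open>A\<close> to
  \<open>B\<close> moves \<open>F\<close> into \<open>V\<close>.\<close>

lemma Homeo_shrinks:
  assumes h: "h_homogeneous X" and X: "zero_dimensional X" "compact_space X" "Hausdorff_space X"
    and F: "closedin X F" "F \<noteq> topspace X" and V: "openin X V" "V \<noteq> {}"
  shows "\<exists>g\<in>Homeo X. g ` F \<subseteq> V"
proof -
  have FX: "F \<subseteq> topspace X" using F(1) by (rule closedin_subset)
  obtain y z where y: "y \<in> topspace X - F" and z: "z \<in> V" using F V FX by blast
  obtain A where A: "openin X A" "closedin X A" "y \<in> A" "A \<subseteq> topspace X - F"
    using clopen_base[OF X(1) _ y] F(1) by blast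
  obtain B where B: "openin X B" "closedin X B" "z \<in> B" "B \<subseteq> V"
    using clopen_base[OF X(1) V(1) z] by blast
  have BX: "B \<subseteq> topspace X" "A \<subseteq> topspace X" using A(1) B(1) openin_subset by blast+
  show ?thesis
  \<comment> \<open>If \<open>A\<close> or \<open>B\<close> is all of \<open>X\<close>, one of the
    colourings has a single colour; but then \<open>F\<close> is empty or \<open>V\<close> is all of
    \<open>X\<close>, and the identity works.\<close>
  proof (cases "A = topspace X \<or> B = topspace X")
    case True
    then have "F \<subseteq> V" using A B FX by blast
    then show ?thesis by (intro bexI[OF _ id_in_Homeo]) simp
  next
    case False
    define p :: "'a \<Rightarrow> nat" where "p x = (if x \<in> A then 0 else 1)" for x
    define q :: "'a \<Rightarrow> nat" where "q x = (if x \<in> B then 1 else 0)" for x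
    have pq: "p \<in> colourings X" "q \<in> colourings X"
      unfolding p_def q_def
      by (rule colouring_if[OF A(1,2) colouring_const], rule colouring_if[OF B(1,2) colouring_const])
    obtain a b where ab: "a \<in> topspace X" "a \<notin> A" "b \<in> topspace X" "b \<notin> B"
      using False BX by blast
    have "p ` topspace X = {0, 1}"
    proof
      show "p ` topspace X \<subseteq> {0, 1}" by (auto simp: p_def)
      have "p y = 0" "p a = 1" using A(3) ab by (auto simp: p_def)
      then show "{0, 1} \<subseteq> p ` topspace X" using y ab(1) by (metis DiffE empty_subsetI imageI insert_subset)
    qed
    moreover have "q ` topspace X = {0, 1}"
    proof
      show "q ` topspace X \<subseteq> {0, 1}" by (auto simp: q_def)
      have "q b = 0" "q z = 1" using B(3) ab by (auto simp: q_def)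
      moreover have "z \<in> topspace X" using B(3) BX by blast
      ultimately show "{0, 1} \<subseteq> q ` topspace X" using ab(3) by (metis empty_subsetI imageI insert_subset)
    qed
    ultimately have eq: "p ` topspace X = q ` topspace X" by simp
    from Homeo_matching_colourings[OF h X(2,3) pq eq]
    obtain g where g: "g \<in> Homeo X" "\<forall>x\<in>topspace X. q (g x) = p x"
      by (elim bexE conjE)
    have "g x \<in> V" if x: "x \<in> F" for x
    proof -
      have "p x = 1" using x A(4) by (auto simp: p_def)
      then have "q (g x) = 1" using g(2) x FX by auto
      then have "g x \<in> B" by (auto simp: q_def split: if_splits)
      then show ?thesis using B(4) by blast
    qed
    then show ?thesis using g(1) by blast
  qed
qed

text \<open>As \<open>X\<close> is infinite, a point is a proper closed subset and can be moved into
  the complement of any proper closed set.\<close>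

lemma minimal_action_Homeo:
  assumes h: "h_homogeneous X" and inf: "infinite (topspace X)"
    and X: "zero_dimensional X" "compact_space X" "Hausdorff_space X"
  shows "minimal_action (Homeo X) X (\<lambda>g x. g x)"
  unfolding minimal_action_def
proof (intro conjI allI impI)
  show "topspace X \<noteq> {}" using inf by auto
  fix A assume A: "closedin X A \<and> A \<noteq> {} \<and> invariant (Homeo X) (\<lambda>g x. g x) A"
  show "A = topspace X"
  proof (rule ccontr)
    assume "A \<noteq> topspace X"
    moreover have AX: "A \<subseteq> topspace X" using A closedin_subset by blast
    ultimately have V: "openin X (topspace X - A)" "topspace X - A \<noteq> {}" using A by blast+
    obtain x where x: "x \<in> A" using A by blast
    have "closedin X {x}" using closedin_Hausdorff_singleton[OF X(3)] x AX by blast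
    moreover have "{x} \<noteq> topspace X" using inf by (metis finite.emptyI finite_insert)
    ultimately obtain g where "g \<in> Homeo X" "g ` {x} \<subseteq> topspace X - A"
      using Homeo_shrinks[OF h X _ _ V] by blast
    then show False using A x unfolding invariant_def by blast
  qed
qed

text \<open>Any point \<open>x\<close> can serve as the limit: \<open>F\<close> can be moved into
  the colour class of \<open>x\<close> for any colouring, and being nonempty it then has the same
  trace as \<open>{x}\<close>.\<close>

lemma extremely_proximal_Homeo:
  assumes h: "h_homogeneous X" and X: "zero_dimensional X" "compact_space X" "Hausdorff_space X"
  shows "extremely_proximal (Homeo X) X"
  unfolding extremely_proximal_def
proof (intro allI impI)
  fix F assume "closedin X F \<and> F \<noteq> {} \<and> F \<noteq> topspace X"
  then have F: "closedin X F" "F \<noteq> {}" "F \<noteq> topspace X" by auto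
  have FX: "F \<in> Exp_set X" using F by (simp add: Exp_set_def)
  obtain x where x: "x \<in> topspace X" using F closedin_subset by blast
  have xE: "{x} \<in> topspace (vietoris X)"
    using closedin_Hausdorff_singleton[OF X(3) x] by (simp add: Exp_set_def)
  obtain N where "net_in (Homeo X) N" "limitin (vietoris X) (\<lambda>g. g ` F) {x} N"
  proof (rule net_exists[OF xE])
    fix W assume W: "openin (vietoris X) W" "{x} \<in> W"
    obtain q' where q': "q' \<in> (`) ` colourings X" "\<And>E. E \<in> topspace (vietoris X) \<Longrightarrow> q' E = q' {x} \<Longrightarrow> E \<in> W"
      using base_maps_open[OF base_maps_vietoris[OF base_maps_colourings[OF X(1)] X(2)] W] by blast
    then obtain q where q: "q \<in> colourings X" "q' = (`) q" by blast
    have V: "openin X {y \<in> topspace X. q y \<in> {q x}}" by (rule colouring_clopen[OF q(1)])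
    have "{y \<in> topspace X. q y \<in> {q x}} \<noteq> {}" using x by blast
    then obtain g where g: "g \<in> Homeo X" "g ` F \<subseteq> {y \<in> topspace X. q y \<in> {q x}}"
      using Homeo_shrinks[OF h X F(1,3) V] by blast
    have "q ` (g ` F) \<subseteq> {q x}" using g(2) by auto
    then have "q ` (g ` F) = q ` {x}" using F(2) by (auto dest: subset_singletonD)
    then have "g ` F \<in> W" using q'(2)[of "g ` F"] q(2) Homeo_image_Exp_set[OF g(1) FX] by simp
    then show "\<exists>g\<in>Homeo X. g ` F \<in> W" using g(1) by blast
  qed
  then show "\<exists>N x0. net_in (Homeo X) N \<and> x0 \<in> topspace X \<and> limitin (vietoris X) (\<lambda>g. g ` F) {x0} N"
    using x by blast
qed

lemma minimal_action_Phi: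
  assumes h: "h_homogeneous X" and inf: "infinite (topspace X)"
    and X: "zero_dimensional X" "compact_space X" "Hausdorff_space X"
  shows "minimal_action (Homeo X) (Phi X) Phi_act"
  unfolding minimal_action_def
proof (intro conjI allI impI)
  have ne: "topspace X \<noteq> {}" using inf by auto
  note top = topspace_Phi[OF X ne]
  show "topspace (Phi X) \<noteq> {}" unfolding top using maximal_chain_exists by blast
  fix A assume A: "closedin (Phi X) A \<and> A \<noteq> {} \<and> invariant (Homeo X) Phi_act A"
  show "A = topspace (Phi X)"
  proof (rule ccontr)
    assume "A \<noteq> topspace (Phi X)"
    moreover have AX: "A \<subseteq> topspace (Phi X)" using A closedin_subset by blast
    ultimately obtain d where d: "d \<in> topspace (Phi X) - A" by blast
    obtain c where c: "c \<in> A" using A by blast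
    have mc: "maximal_chain X c" "maximal_chain X d" using c d AX top by blast+
    have "openin (Phi X) (topspace (Phi X) - A)" using A by blast
    from Phi_neighbourhood[OF X ne this d]
    obtain q where q: "q \<in> colourings X"
      "\<forall>c. maximal_chain X c \<and> (`) q ` c = (`) q ` d \<longrightarrow> c \<in> topspace (Phi X) - A" ..
    \<comment> \<open>With both chains equal to \<open>c\<close>, matching traces with
      \<open>d\<close> moves \<open>c\<close> into the complement of \<open>A\<close>.\<close>
    from Homeo_match_traces[OF h inf X mc(1) mc(1) mc(2) q(1)]
    obtain g where g: "g \<in> Homeo X" "(`) q ` Phi_act g c = (`) q ` d" by (elim bexE conjE)
    have "maximal_chain X (Phi_act g c)" by (rule maximal_chain_Phi_act[OF g(1) mc(1)])
    then have "Phi_act g c \<notin> A" using q(2) g(2) by blast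
    then show False using A c g(1) unfolding invariant_def by blast
  qed
qed

text \<open>\<open>c1\<close> itself serves as the common limit. Both orbits must converge along one
  net, so the net is built in the product space, with limit \<open>(c1, c1)\<close>.\<close>

lemma proximal_action_Phi:
  assumes h: "h_homogeneous X" and inf: "infinite (topspace X)"
    and X: "zero_dimensional X" "compact_space X" "Hausdorff_space X"
  shows "proximal_action (Homeo X) (Phi X) Phi_act"
  unfolding proximal_action_def
proof (intro ballI)
  have ne: "topspace X \<noteq> {}" using inf by auto
  note top = topspace_Phi[OF X ne]
  fix c1 c2 assume c12: "c1 \<in> topspace (Phi X)" "c2 \<in> topspace (Phi X)"
  then have c: "maximal_chain X c1" "maximal_chain X c2" unfolding top by simp_all
  have "(c1, c1) \<in> topspace (prod_topology (Phi X) (Phi X))" using c12(1) by simp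
  then obtain N where N: "net_in (Homeo X) N"
    "limitin (prod_topology (Phi X) (Phi X)) (\<lambda>g. (Phi_act g c1, Phi_act g c2)) (c1, c1) N"
  proof (rule net_exists)
    fix W assume W: "openin (prod_topology (Phi X) (Phi X)) W" "(c1, c1) \<in> W"
    from W(1)[unfolded openin_prod_topology_alt, rule_format, OF W(2)]
    obtain U V where UV: "openin (Phi X) U" "openin (Phi X) V" "c1 \<in> U" "c1 \<in> V" "U \<times> V \<subseteq> W"
      by blast
    have "openin (Phi X) (U \<inter> V)" "c1 \<in> U \<inter> V" using UV by auto
    from Phi_neighbourhood[OF X ne this]
    obtain q where q: "q \<in> colourings X"
      "\<forall>c. maximal_chain X c \<and> (`) q ` c = (`) q ` c1 \<longrightarrow> c \<in> U \<inter> V" ..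
    from Homeo_match_traces[OF h inf X c c(1) q(1)]
    obtain g where g: "g \<in> Homeo X" "(`) q ` Phi_act g c1 = (`) q ` c1" "(`) q ` Phi_act g c2 = (`) q ` c1"
      by (elim bexE conjE)
    have "maximal_chain X (Phi_act g c1)" "maximal_chain X (Phi_act g c2)"
      by (rule maximal_chain_Phi_act[OF g(1)], rule c)+
    then have "Phi_act g c1 \<in> U \<inter> V" "Phi_act g c2 \<in> U \<inter> V"
      using q(2) g(2,3) by blast+
    then show "\<exists>g\<in>Homeo X. (Phi_act g c1, Phi_act g c2) \<in> W" using UV(5) g(1) by blast
  qed
  then show "\<exists>F z. net_in (Homeo X) F \<and> limitin (Phi X) (\<lambda>g. Phi_act g c1) z F \<and>
      limitin (Phi X) (\<lambda>g. Phi_act g c2) z F"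
    by (auto simp: limitin_pairwise o_def)
qed

section \<open>Continuity of the action on \<Phi>(X)\<close>

lemma topspace_compact_open: "topspace (compact_open X) = Homeo X"
proof -
  have "Homeo X \<in> {{g \<in> Homeo X. g ` K \<subseteq> U} |K U. compactin X K \<and> openin X U}"
    by (intro CollectI exI[of _ "{}"]) simp
  then show ?thesis
    unfolding compact_open_def topology_generated_by_topspace by blast
qed

text \<open>A clopen neighbourhood \<open>K\<close> of \<open>x\<close> inside the preimage of
  \<open>U\<close> is compact, so the maps sending \<open>K\<close> into \<open>U\<close> form a
  subbasic neighbourhood of \<open>g\<close>.\<close>

lemma continuous_map_evaluation:
  assumes X: "zero_dimensional X" "compact_space X"
  shows "continuous_map (prod_topology (compact_open X) X) X (\<lambda>(g, x). g x)"
  unfolding continuous_map_def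
proof (intro conjI allI impI)
  let ?P = "prod_topology (compact_open X) X"
  show "(\<lambda>(g, x). g x) \<in> topspace ?P \<rightarrow> topspace X"
    using Homeo_image[of _ X] by (auto simp: topspace_compact_open)
  fix U assume U: "openin X U"
  show "openin ?P {z \<in> topspace ?P. (\<lambda>(g, x). g x) z \<in> U}"
  proof (subst openin_subopen, intro ballI)
    fix z assume "z \<in> {z \<in> topspace ?P. (\<lambda>(g, x). g x) z \<in> U}"
    then obtain g x where z: "z = (g, x)" "g \<in> Homeo X" "x \<in> topspace X" "g x \<in> U"
      by (auto simp: topspace_compact_open)
    have "openin X {y \<in> topspace X. g y \<in> U}"
      using openin_continuous_map_preimage[OF Homeo_continuous[OF z(2)] U] .
    moreover have "x \<in> {y \<in> topspace X. g y \<in> U}" using z by simp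
    ultimately obtain K where K: "openin X K" "closedin X K" "x \<in> K" "K \<subseteq> {y \<in> topspace X. g y \<in> U}"
      using clopen_base[OF X(1)] by blast
    define B where "B = {g \<in> Homeo X. g ` K \<subseteq> U}"
    have "compactin X K" using closedin_compact_space[OF X(2) K(2)] .
    then have "openin (compact_open X) B"
      unfolding compact_open_def B_def using U by (intro topology_generated_by_Basis) blast
    then have "openin ?P (B \<times> K)" using K(1) by (simp add: openin_prod_Times_iff)
    moreover have "z \<in> B \<times> K" using z K by (auto simp: B_def)
    moreover have "B \<times> K \<subseteq> {z \<in> topspace ?P. (\<lambda>(g, x). g x) z \<in> U}"
      using openin_subset[OF K(1)] by (auto simp: B_def topspace_compact_open)
    ultimately show "\<exists>S. openin ?P S \<and> z \<in> S \<and> S \<subseteq> {z \<in> topspace ?P. (\<lambda>(g, x). g x) z \<in> U}"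
      by blast
  qed
qed

text \<open>Two applications of \<open>continuous_map_vietoris_action\<close> lift evaluation to the
  second hyperspace, where the maximal chains form an invariant subspace.\<close>

lemma G_space_Phi:
  assumes X: "zero_dimensional X" "compact_space X" "Hausdorff_space X" "topspace X \<noteq> {}"
  shows "G_space (compact_open X) (Phi X) Phi_act"
  unfolding G_space_def
proof (intro conjI ballI)
  show "compact_space (Phi X)" "Hausdorff_space (Phi X)" using compact_Hausdorff_Phi[OF X] by auto
  have V: "compact_space (vietoris X)" "Hausdorff_space (vietoris X)"
    using X compact_space_vietoris Hausdorff_space_vietoris compact_Hausdorff_imp_regular_space by blast+
  let ?T = "compact_open X" and ?V = "vietoris (vietoris X)"
  have c1: "continuous_map (prod_topology ?T (vietoris X)) (vietoris X) (\<lambda>(g, F). g ` F)"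
    by (rule continuous_map_vietoris_action[OF continuous_map_evaluation[OF X(1,2)] X(2,3)])
  have c2: "continuous_map (prod_topology ?T ?V) ?V (\<lambda>(g, c). Phi_act g c)"
    unfolding Phi_act_def by (rule continuous_map_vietoris_action[OF c1 V])
  have "continuous_map (prod_topology ?T (Phi X)) (Phi X) snd" by (rule continuous_map_snd)
  then have "continuous_map (prod_topology ?T (Phi X)) ?V snd"
    unfolding Phi_def by (rule continuous_map_into_fulltopology)
  then have "continuous_map (prod_topology ?T (Phi X)) (prod_topology ?T ?V) (\<lambda>z. (fst z, snd z))"
    by (intro continuous_map_paired[THEN iffD2] conjI continuous_map_fst)
  from continuous_map_compose[OF this c2]
  have "continuous_map (prod_topology ?T (Phi X)) ?V (\<lambda>(g, c). Phi_act g c)"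
    by (simp add: o_def case_prod_unfold)
  moreover have "(\<lambda>(g, c). Phi_act g c) \<in> topspace (prod_topology ?T (Phi X)) \<rightarrow> {c. maximal_chain X c}"
    using maximal_chain_Phi_act by (auto simp: topspace_compact_open topspace_Phi[OF X])
  ultimately show "continuous_map (prod_topology ?T (Phi X)) (Phi X) (\<lambda>(g, c). Phi_act g c)"
    unfolding Phi_def[of X] by (intro continuous_map_into_subtopology)
qed (auto simp: Phi_act_def image_image)

section \<open>Copies of G-spaces and non-universality of \<open>X\<close>\<close>

text \<open>\<open>universal_minimal\<close> tests spaces on the type
  \<open>('a => 'a) set set\<close>, whereas \<Phi>(X) lives on \<open>'a set set\<close>. Transport
  along a homeomorphism makes a copy of \<Phi>(X) available as a test space.\<close>

lemma G_space_transport: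
  assumes ef: "homeomorphic_maps Y Z e f" and Y: "G_space T Y act"
  shows "G_space T Z (\<lambda>g z. e (act g (f z)))"
  unfolding G_space_def
proof (intro conjI ballI)
  have e: "continuous_map Y Z e" and f: "continuous_map Z Y f"
    and fe: "\<And>y. y \<in> topspace Y \<Longrightarrow> f (e y) = y" and ef': "\<And>z. z \<in> topspace Z \<Longrightarrow> e (f z) = z"
    using ef by (auto simp: homeomorphic_maps_def)
  have act: "continuous_map (prod_topology T Y) Y (\<lambda>(g, y). act g y)"
    using Y by (simp add: G_space_def)
  have hs: "Y homeomorphic_space Z" using ef unfolding homeomorphic_space_def by blast
  have "compact_space Y" "Hausdorff_space Y" using Y by (auto simp: G_space_def)
  then show "compact_space Z" "Hausdorff_space Z"
    using homeomorphic_compact_space[OF hs] homeomorphic_Hausdorff_space[OF hs] by auto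
  have "continuous_map (prod_topology T Z) (prod_topology T Y) (\<lambda>z. (fst z, f (snd z)))"
    using continuous_map_compose[OF continuous_map_snd f, of T] 
    by (intro continuous_map_paired[THEN iffD2] conjI continuous_map_fst) (simp add: o_def)
  from continuous_map_compose[OF continuous_map_compose[OF this act] e]
  show "continuous_map (prod_topology T Z) Z (\<lambda>(g, z). e (act g (f z)))"
    by (simp add: o_def case_prod_unfold)
  have fZ: "f z \<in> topspace Y" if "z \<in> topspace Z" for z
    using continuous_map_image_subset_topspace[OF f] that by blast
  have actY: "act g y \<in> topspace Y" if "g \<in> topspace T" "y \<in> topspace Y" for g y
    using continuous_map_image_subset_topspace[OF act] that by force
  show "e (act id (f z)) = z" if "z \<in> topspace Z" for z
    using Y fZ[OF that] ef'[OF that] by (simp add: G_space_def)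
  show "e (act (g \<circ> h) (f z)) = e (act g (f (e (act h (f z)))))"
    if "g \<in> topspace T" "h \<in> topspace T" "z \<in> topspace Z" for g h z
    using Y that fZ[OF that(3)] fe[OF actY[OF that(2) fZ[OF that(3)]]] by (simp add: G_space_def)
qed

lemma minimal_action_transport:
  assumes ef: "homeomorphic_maps Y Z e f" and Y: "minimal_action G Y act"
    and act: "\<And>g y. g \<in> G \<Longrightarrow> y \<in> topspace Y \<Longrightarrow> act g y \<in> topspace Y"
  shows "minimal_action G Z (\<lambda>g z. e (act g (f z)))"
  unfolding minimal_action_def
proof (intro conjI allI impI)
  have e: "continuous_map Y Z e" and f: "continuous_map Z Y f"
    and fe: "\<And>y. y \<in> topspace Y \<Longrightarrow> f (e y) = y" and ef': "\<And>z. z \<in> topspace Z \<Longrightarrow> e (f z) = z"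
    using ef by (auto simp: homeomorphic_maps_def)
  have eY: "e y \<in> topspace Z" if "y \<in> topspace Y" for y
    using continuous_map_image_subset_topspace[OF e] that by blast
  have fZ: "f z \<in> topspace Y" if "z \<in> topspace Z" for z
    using continuous_map_image_subset_topspace[OF f] that by blast
  show "topspace Z \<noteq> {}" using Y eY unfolding minimal_action_def by blast
  fix A assume A: "closedin Z A \<and> A \<noteq> {} \<and> invariant G (\<lambda>g z. e (act g (f z))) A"
  have AZ: "A \<subseteq> topspace Z" using A closedin_subset by blast
  define B where "B = {y \<in> topspace Y. e y \<in> A}"
  have "closedin Y B" unfolding B_def using closedin_continuous_map_preimage[OF e] A by blast
  moreover obtain a where "a \<in> A" using A by blast
  then have "f a \<in> B" using AZ fZ ef' by (auto simp: B_def)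
  moreover have "act g y \<in> B" if "g \<in> G" "y \<in> B" for g y
  proof -
    have y: "y \<in> topspace Y" "e y \<in> A" using that(2) by (auto simp: B_def)
    have "e (act g (f (e y))) \<in> A" using A that(1) y(2) unfolding invariant_def by blast
    then show ?thesis using fe[OF y(1)] act[OF that(1) y(1)] by (simp add: B_def)
  qed
  ultimately have B: "B = topspace Y" using Y unfolding minimal_action_def invariant_def by blast
  have "z \<in> A" if "z \<in> topspace Z" for z
    using fZ[OF that] ef'[OF that] unfolding B[symmetric] by (simp add: B_def)
  then show "A = topspace Z" using AZ by blast
qed

text \<open>The copy is the image of \<open>Y\<close> under \<open>e\<close>, with the topology
  pulled back along \<open>inv e\<close>.\<close>

lemma homeomorphic_copy:
  assumes "inj e"
  obtains Z f where "homeomorphic_maps Y Z e f"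
proof
  let ?Z = "pullback_topology (e ` topspace Y) (inv e) Y"
  have inv: "inv e (e y) = y" for y using assms by simp
  have top: "topspace ?Z = e ` topspace Y" using inv by (auto simp: topspace_pullback_topology)
  have "continuous_map ?Z Y (inv e)"
    using continuous_map_pullback[OF continuous_map_id[of Y], of "e ` topspace Y" "inv e"] by simp
  moreover have "continuous_map Y ?Z e"
    by (rule continuous_map_pullback') (auto simp: o_def inv)
  ultimately show "homeomorphic_maps Y ?Z e (inv e)"
    unfolding homeomorphic_maps_def top using inv by auto
qed

text \<open>A maximal chain fixed by the stabiliser of a point \<open>x\<close> would not separate two disjoint
  clopen sets that a homeomorphism fixing \<open>x\<close> can swap.\<close>
lemma no_equivariant_map_to_Phi:
  assumes h: "h_homogeneous X" and inf: "infinite (topspace X)"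
    and X: "zero_dimensional X" "compact_space X" "Hausdorff_space X"
    and f: "\<And>x. x \<in> topspace X \<Longrightarrow> maximal_chain X (f x)"
      "\<And>g x. g \<in> Homeo X \<Longrightarrow> x \<in> topspace X \<Longrightarrow> f (g x) = Phi_act g (f x)"
  shows False
proof -
  obtain x where x: "x \<in> topspace X" using inf by (metis ex_in_conv finite.emptyI)
  have c: "maximal_chain X (f x)" using f(1)[OF x] .
  \<comment> \<open>Three colours leave two, \<open>a\<close> and \<open>b\<close>, that differ from
    the colour of \<open>x\<close>.\<close>
  have "finite {0::nat, 1, 2}" "{0::nat, 1, 2} \<noteq> {}" by auto
  from initial_segment_colouring[OF h inf X c c this]
  obtain p where p: "p \<in> colourings X" "p ` topspace X = {0, 1, 2}" by (elim bexE conjE)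
  have "p x \<in> {0, 1, 2}" using p(2) x by blast
  then have "\<exists>a b. a \<in> {0, 1, 2} \<and> b \<in> {0, 1, 2} \<and> a \<noteq> b \<and> p x \<noteq> a \<and> p x \<noteq> b"
  proof (elim insertE)
    show ?thesis if "p x = 0" using that by (intro exI[of _ 1] exI[of _ 2]) simp
    show ?thesis if "p x = 1" using that by (intro exI[of _ 0] exI[of _ 2]) simp
    show ?thesis if "p x = 2" using that by (intro exI[of _ 0] exI[of _ 1]) simp
  qed simp
  then obtain a b where ab: "a \<in> {0, 1, 2}" "b \<in> {0, 1, 2}" "a \<noteq> b" "p x \<noteq> a" "p x \<noteq> b"
    by (elim exE conjE)
  \<comment> \<open>\<open>s\<close> swaps \<open>a\<close> and \<open>b\<close>. Matching
    \<open>p\<close> with its composition with \<open>s\<close> gives a homeomorphism that swaps the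
    two fibres and fixes \<open>x\<close>, whose fibre is the same for both colourings.\<close>
  define s where "s n = (if n = a then b else if n = b then a else n)" for n
  have ss: "s (s n) = n" for n by (simp add: s_def)
  have sN: "s ` {0, 1, 2} = {0, 1, 2}"
  proof -
    have sub: "s ` {0, 1, 2} \<subseteq> {0, 1, 2}" using ab(1,2) by (auto simp: s_def)
    then have "s ` s ` {0, 1, 2} \<subseteq> s ` {0, 1, 2}" by (rule image_mono)
    then show ?thesis using sub by (simp only: image_image ss image_ident subset_antisym)
  qed
  define q where "q y = s (p y)" for y
  have q: "q \<in> colourings X" unfolding q_def using colouring_compose[OF p(1)] .
  have "q ` topspace X = s ` p ` topspace X" by (simp add: q_def image_image)
  then have pq: "p ` topspace X = q ` topspace X" using p(2) sN by simp
  from Homeo_matching_colourings[OF h X(2,3) p(1) q pq]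
  obtain g where g: "g \<in> Homeo X" "\<forall>x\<in>topspace X. q (g x) = p x"
    "\<forall>x\<in>topspace X. {y \<in> topspace X. p y = p x} = {y \<in> topspace X. q y = p x} \<longrightarrow> g x = x"
    by (elim bexE conjE)
  have "q y = p x \<longleftrightarrow> p y = p x" for y using ab by (auto simp: q_def s_def)
  then have "g x = x" using g(3) x by simp
  then have gfx: "Phi_act g (f x) = f x" using f(2)[OF g(1) x] by simp
  have full: "full_chain {0, 1, 2} ((`) p ` f x)"
    using full_chain_trace[OF c _ X(2), of p] p by (simp add: colourings_def)
  \<comment> \<open>Some trace \<open>S\<close> contains exactly one of \<open>a\<close> and
    \<open>b\<close>. As \<open>g\<close> fixes the chain, the image of \<open>S\<close> under
    \<open>s\<close> is a trace as well, but neither of the two includes the other.\<close>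
  obtain S where S: "S \<in> (`) p ` f x" "(a \<in> S) \<noteq> (b \<in> S)"
    using full_chain_separates[OF full ab(1,3)] by blast
  then obtain F where F: "F \<in> f x" "S = p ` F" by blast
  have FX: "F \<subseteq> topspace X" using maximal_chainD(1)[OF c F(1)] by (rule Exp_set_subset_topspace)
  have "p (g y) = s (p y)" if "y \<in> F" for y
  proof -
    have "s (q (g y)) = s (p y)" using g(2) that FX by auto
    then show ?thesis by (simp add: q_def ss)
  qed
  then have "p ` (g ` F) = s ` S" unfolding F(2) by (simp add: image_image cong: image_cong)
  moreover have "g ` F \<in> f x" using gfx F(1) unfolding Phi_act_def by blast
  ultimately have "s ` S \<in> (`) p ` f x" by (metis imageI)
  then have "S \<subseteq> s ` S \<or> s ` S \<subseteq> S" using full_chain_comparable[OF full S(1)] by blast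
  moreover have "a \<in> s ` S \<longleftrightarrow> b \<in> S" "b \<in> s ` S \<longleftrightarrow> a \<in> S"
  proof -
    have "s n \<in> s ` S \<longleftrightarrow> n \<in> S" for n using ss by (metis imageE imageI)
    from this[of b] this[of a] show "a \<in> s ` S \<longleftrightarrow> b \<in> S" "b \<in> s ` S \<longleftrightarrow> a \<in> S"
      using ab(3) by (simp_all add: s_def)
  qed
  ultimately show False using S(2) by blast
qed

text \<open>Universality would give an equivariant map from \<open>X\<close> to a copy of the
  minimal space \<Phi>(X); composed with the homeomorphism back to \<Phi>(X), it contradicts
  \<open>no_equivariant_map_to_Phi\<close>.\<close>

lemma not_universal_minimal_Homeo:
  fixes X :: "'a topology"
  assumes h: "h_homogeneous X" and inf: "infinite (topspace X)"
    and X: "zero_dimensional X" "compact_space X" "Hausdorff_space X"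
  shows "\<not> universal_minimal (compact_open X) X (\<lambda>g x. g x)"
proof
  assume univ: "universal_minimal (compact_open X) X (\<lambda>g x. g x)"
  have ne: "topspace X \<noteq> {}" using inf by auto
  \<comment> \<open>Turning points into constant maps embeds \<open>'a set set\<close> in the type
    over which \<open>universal_minimal\<close> quantifies.\<close>
  define e where "e = (`) ((`) (\<lambda>(x::'a) (y::'a). x))"
  have "inj (\<lambda>(x::'a) (y::'a). x)" by (rule injI) (metis)
  then have "inj e" unfolding e_def by (simp add: inj_def inj_image_eq_iff)
  then obtain Z r where Z: "homeomorphic_maps (Phi X) Z e r"
    by (rule homeomorphic_copy)
  have actY: "Phi_act g c \<in> topspace (Phi X)" if "g \<in> Homeo X" "c \<in> topspace (Phi X)" for g c
    using that maximal_chain_Phi_act by (simp add: topspace_Phi[OF X ne])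
  have "G_space (compact_open X) Z (\<lambda>g z. e (Phi_act g (r z)))"
    by (rule G_space_transport[OF Z G_space_Phi[OF X ne]])
  moreover have "minimal_action (topspace (compact_open X)) Z (\<lambda>g z. e (Phi_act g (r z)))"
    unfolding topspace_compact_open
    by (rule minimal_action_transport[OF Z minimal_action_Phi[OF h inf X] actY])
  ultimately obtain f where f: "G_map_onto (Homeo X) X (\<lambda>g x. g x) Z (\<lambda>g z. e (Phi_act g (r z))) f"
    using univ unfolding universal_minimal_def topspace_compact_open by blast
  have rZ: "r z \<in> topspace (Phi X)" if "z \<in> topspace Z" for z
    using Z that by (auto simp: homeomorphic_maps_def continuous_map_def)
  have fx: "f x \<in> topspace Z" if "x \<in> topspace X" for x
    using f that by (auto simp: G_map_onto_def)
  show False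
  proof (rule no_equivariant_map_to_Phi[OF h inf X, of "\<lambda>x. r (f x)"])
    show "maximal_chain X (r (f x))" if "x \<in> topspace X" for x
      using rZ[OF fx[OF that]] by (simp add: topspace_Phi[OF X ne])
    show "r (f (g x)) = Phi_act g (r (f x))" if "g \<in> Homeo X" "x \<in> topspace X" for g x
    proof -
      have "f (g x) = e (Phi_act g (r (f x)))" using f that by (simp add: G_map_onto_def)
      then show ?thesis
        using Z actY[OF that(1) rZ[OF fx[OF that(2)]]] by (simp add: homeomorphic_maps_def)
    qed
  qed
qed

theorem theorem3p5:
  fixes X :: "'a topology"
  assumes "infinite (topspace X)"
    and "h_homogeneous X"
    and "zero_dimensional X"
    and "compact_space X"
    and "Hausdorff_space X"
  defines "G \<equiv> Homeo X"
  shows "minimal_action G X (\<lambda>g x. g x)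
       \<and> extremely_proximal G X
       \<and> \<not> universal_minimal (compact_open X) X (\<lambda>g x. g x)
       \<and> minimal_action G (Phi X) Phi_act
       \<and> proximal_action G (Phi X) Phi_act"
  unfolding G_def
  using minimal_action_Homeo[OF assms(2,1,3-5)] extremely_proximal_Homeo[OF assms(2-5)]
    not_universal_minimal_Homeo[OF assms(2,1,3-5)] minimal_action_Phi[OF assms(2,1,3-5)]
    proximal_action_Phi[OF assms(2,1,3-5)] by blast

end
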